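(* Let $(\boldsymbol V,\Phi)$ be an admissible primitive lattice substitution system such that $\Phi$ is bijective and $\boldsymbol V$ is nonperiodic. Then $\boldsymbol V$ does not consist of model sets (i.e. it is not the case that every $V_i$ is a model set), and therefore $\boldsymbol V$ is not pure point diffractive.
   Context: A matrix function system (MFS) is an $m\times m$ matrix $\Phi=(\Phi_{ij})$ whose entries are finite (possibly empty) sets of maps $x\mapsto Qx+a_{ijk}$ on $\mathbb R^d$, where $Q$ is one fixed expansive linear map (all eigenvalues of modulus $>1$) and $a_{ijk}\in\mathbb R^d$. It is primitive if its substitution matrix $S(\Phi)=(\#\Phi_{ij})_{i,j}$ is primitive, i.e. some power has only strictly positive entries. Powers are defined by composition: $(\Phi^{k+1})_{ij}=\bigcup_{\ell}\{g\circ f : g\in(\Phi^k)_{i\ell},\ f\in\Phi_{\ell j}\}$. For $\boldsymbol V=(V_1,\dots,V_m)^T$ with $V_i\subset\mathbb R^d$, $\Phi\boldsymbol V=(W_1,\dots,W_m)$ with $W_i=\bigcup_j\bigcup_{f\in\Phi_{ij}}f(V_j)$. A lattice substitution system (LSS) with $m$ components is a pair $(\boldsymbol V,\Phi)$ with $\Phi\boldsymbol V=\boldsymbol V$, the $V_i$ mutually disjoint, the unions $V_i=\bigcup_{j}\bigcup_{f\in\Phi_{ij}}f(V_j)$ pairwise disjoint for every $i$, and $L:=\operatorname{supp}(\boldsymbol V)=\bigcup_iV_i$ a lattice in $\mathbb R^d$. It is primitive if $\Phi$ is. Standing assumption: for every $r>0$, every $r$-cluster $(V_1\cap(x+r\mathbb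 B^d),\dots,V_m\cap(x+r\mathbb B^d))$ of $\boldsymbol V$ ($\mathbb B^d$ the closed unit ball) is, up to translation, contained in $\Phi^k(\boldsymbol v)$ for some $k\in\mathbb N$ and some single point $\boldsymbol v$ of some type $i$ (a vector of sets whose $i$-th entry is a one-point set, all others being empty). A primitive LSS is admissible if the translational parts of all maps in $\Phi$ belong to one fixed system of representatives (containing $0$) in $L$ of $L/QL$. An admissible primitive LSS is bijective if each map $\varphi$ occurring in $\Phi$ appears exactly once in each row of $\Phi$. $\boldsymbol V$ is nonperiodic if the only $x\in\mathbb R^d$ with $\boldsymbol V+x=\boldsymbol V$ (componentwise, i.e. $V_i+x=V_i$ for all $i$) is $x=0$. Model sets: a cut and project scheme consists of a locally compact Abelian group $H$ and a lattice $\tilde L\subset\mathbb R^d\times H$ (discrete subgroup with compact quotient) such that the canonical projection $\pi:\mathbb R^d\times H\to\mathbb R^d$ is injective on $\tilde L$ and the canonical projection $\pi_{\rm int}:\mathbb R^d\times H\to H$ maps $\tilde L$ onto a dense subset of $H$. A model set in $\mathbb R^d$ is a set which, up to translation, has the form $\Lambda(\Omega)=\{\pi(x) : x\in\tilde L,\ \pi_{\rm int}(x)\in\Omega\}$ for some cut and project scheme, where $\Omega\subset H$ has nonempty interior and compact closure. $\boldsymbol V$ is pure point diffractive if each $V_i$ is pure point diffractive, i.e. the diffraction measure of $V_i$ (the Fourier transform of the autocorrelation measure of $\sum_{x\in V_i}\delta_x$) is a pure point measure. *)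

theory Defs
  imports "HOL-Analysis.Analysis" "HOL-Algebra.Coset"
begin

section \<open>Matrix function systems\<close>

text \<open>
  A matrix function system is a function of two indices in a finite type \<open>'m\<close> whose values are
  finite sets of affine maps with the common linear part \<open>Q\<close>; the dimension is \<open>CARD('n)\<close>.
\<close>

type_synonym ('n, 'm) mfs = "'m \<Rightarrow> 'm \<Rightarrow> (real^'n \<Rightarrow> real^'n) set"

text \<open>The eigenvalues are complex, so the real matrix is complexified.\<close>

definition expansive :: "real^'n^'n \<Rightarrow> bool" where
  "expansive Q \<longleftrightarrow>
     (\<forall>z::complex. \<forall>v::complex^'n. v \<noteq> 0 \<and> map_matrix complex_of_real Q *v v = z *s v \<longrightarrow> 1 < norm z)"

definition matrix_function_system :: "real^'n^'n \<Rightarrow> ('n, 'm::finite) mfs \<Rightarrow> bool" where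
  "matrix_function_system Q \<Phi> \<longleftrightarrow>
     expansive Q \<and>
     (\<forall>i j. finite (\<Phi> i j) \<and> (\<forall>f\<in>\<Phi> i j. \<exists>a. f = (\<lambda>x. Q *v x + a)))"

definition substitution_matrix :: "('n, 'm::finite) mfs \<Rightarrow> nat^'m^'m" where
  "substitution_matrix \<Phi> = (\<chi> i j. card (\<Phi> i j))"

text \<open>The instance of \<open>^\<close> for vectors is componentwise, hence the iterated matrix product.\<close>

definition primitive_mfs :: "('n, 'm::finite) mfs \<Rightarrow> bool" where
  "primitive_mfs \<Phi> \<longleftrightarrow>
     (\<exists>k>0. \<forall>i j. 0 < (((**) (substitution_matrix \<Phi>) ^^ k) (mat 1)) $ i $ j)"

text \<open>The zeroth power is the identity system, so that the first power is \<open>\<Phi>\<close> itself.\<close>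

primrec mfs_power :: "('n, 'm::finite) mfs \<Rightarrow> nat \<Rightarrow> ('n, 'm) mfs" where
  "mfs_power \<Phi> 0 = (\<lambda>i j. if i = j then {id} else {})"
| "mfs_power \<Phi> (Suc k) = (\<lambda>i j. \<Union>l. {g \<circ> f |g f. g \<in> mfs_power \<Phi> k i l \<and> f \<in> \<Phi> l j})"

definition mfs_apply ::
    "('n, 'm::finite) mfs \<Rightarrow> ('m \<Rightarrow> (real^'n) set) \<Rightarrow> ('m \<Rightarrow> (real^'n) set)" where
  "mfs_apply \<Phi> V = (\<lambda>i. \<Union>j. \<Union>f\<in>\<Phi> i j. f ` V j)"

section \<open>Lattices\<close>

text \<open>
  A lattice in a topological group: a discrete subgroup with compact quotient.
  A topology \<open>Y\<close> making the projection onto the cosets a quotient map exists and is unique; it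
  is the quotient topology.
\<close>

definition group_lattice :: "'g monoid \<Rightarrow> 'g topology \<Rightarrow> 'g set \<Rightarrow> bool" where
  "group_lattice G T L \<longleftrightarrow>
     subgroup L G \<and>
     subtopology T L = discrete_topology L \<and>
     (\<exists>Y. quotient_map T Y (\<lambda>g. L #>\<^bsub>G\<^esub> g) \<and> compact_space Y)"

definition euclidean_group :: "(real^'n) monoid" where
  "euclidean_group = \<lparr>carrier = UNIV, mult = (+), one = 0\<rparr>"

definition euclidean_lattice :: "(real^'n) set \<Rightarrow> bool" where
  "euclidean_lattice L \<longleftrightarrow> group_lattice euclidean_group euclidean L"

section \<open>Lattice substitution systems\<close>

definition lattice_substitution_system ::
    "real^'n^'n \<Rightarrow> ('m::finite \<Rightarrow> (real^'n) set) \<Rightarrow> ('n, 'm) mfs \<Rightarrow> bool" where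
  "lattice_substitution_system Q V \<Phi> \<longleftrightarrow>
     matrix_function_system Q \<Phi> \<and>
     mfs_apply \<Phi> V = V \<and>
     disjoint_family V \<and>
     (\<forall>i. disjoint_family_on (\<lambda>(j, f). f ` V j) (SIGMA j:UNIV. \<Phi> i j)) \<and>
     euclidean_lattice (\<Union>i. V i)"

definition single_point :: "'m \<Rightarrow> real^'n \<Rightarrow> 'm \<Rightarrow> (real^'n) set" where
  "single_point i p = (\<lambda>j. if j = i then {p} else {})"

definition clusters_legal :: "('m::finite \<Rightarrow> (real^'n) set) \<Rightarrow> ('n, 'm) mfs \<Rightarrow> bool" where
  "clusters_legal V \<Phi> \<longleftrightarrow>
     (\<forall>r>0. \<forall>x. \<exists>k i p t. \<forall>j.
        (+) t ` (V j \<inter> cball x r) \<subseteq> mfs_apply (mfs_power \<Phi> k) (single_point i p) j)"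

definition coset_representatives :: "real^'n^'n \<Rightarrow> (real^'n) set \<Rightarrow> (real^'n) set \<Rightarrow> bool" where
  "coset_representatives Q L D \<longleftrightarrow> D \<subseteq> L \<and> (\<forall>x\<in>L. \<exists>!d. d \<in> D \<and> x - d \<in> (*v) Q ` L)"

definition admissible ::
    "real^'n^'n \<Rightarrow> ('m::finite \<Rightarrow> (real^'n) set) \<Rightarrow> ('n, 'm) mfs \<Rightarrow> bool" where
  "admissible Q V \<Phi> \<longleftrightarrow>
     (\<exists>D. coset_representatives Q (\<Union>i. V i) D \<and> 0 \<in> D \<and>
          (\<forall>i j. \<forall>f\<in>\<Phi> i j. \<exists>a\<in>D. f = (\<lambda>x. Q *v x + a)))"

definition bijective_mfs :: "('n, 'm::finite) mfs \<Rightarrow> bool" where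
  "bijective_mfs \<Phi> \<longleftrightarrow> (\<forall>\<phi> \<in> (\<Union>i j. \<Phi> i j). \<forall>i. \<exists>!j. \<phi> \<in> \<Phi> i j)"

definition nonperiodic :: "('m \<Rightarrow> (real^'n) set) \<Rightarrow> bool" where
  "nonperiodic V \<longleftrightarrow> (\<forall>x. (\<forall>i. (+) x ` V i = V i) \<longrightarrow> x = 0)"

section \<open>Model sets\<close>

definition lca_group :: "'h monoid \<Rightarrow> 'h topology \<Rightarrow> bool" where
  "lca_group H T \<longleftrightarrow>
     comm_group H \<and> topspace T = carrier H \<and>
     continuous_map (prod_topology T T) T (\<lambda>(x, y). x \<otimes>\<^bsub>H\<^esub> y) \<and>
     continuous_map T T (\<lambda>x. inv\<^bsub>H\<^esub> x) \<and>
     Hausdorff_space T \<and> locally_compact_space T"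

definition cut_and_project_scheme ::
    "'h monoid \<Rightarrow> 'h topology \<Rightarrow> ((real^'n) \<times> 'h) set \<Rightarrow> bool" where
  "cut_and_project_scheme H T L \<longleftrightarrow>
     lca_group H T \<and>
     group_lattice (euclidean_group \<times>\<times> H) (prod_topology euclidean T) L \<and>
     inj_on fst L \<and>
     T closure_of (snd ` L) = topspace T"

definition projected_set :: "((real^'n) \<times> 'h) set \<Rightarrow> 'h set \<Rightarrow> (real^'n) set" where
  "projected_set L \<Omega> = {fst x |x. x \<in> L \<and> snd x \<in> \<Omega>}"

text \<open>
  The internal groups range over all locally compact Abelian groups whose carrier is a set of
  elements of \<open>'h\<close>. A theorem that leaves \<open>'h\<close> a free type variable thus covers all internal
  groups; several sets may use different groups over the same \<open>'h\<close>.
\<close>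

definition model_set :: "'h itself \<Rightarrow> (real^'n) set \<Rightarrow> bool" where
  "model_set (_ :: 'h itself) S \<longleftrightarrow>
     (\<exists>(H :: 'h monoid) T L \<Omega> t.
        cut_and_project_scheme H T L \<and>
        \<Omega> \<subseteq> carrier H \<and>
        T interior_of \<Omega> \<noteq> {} \<and>
        compactin T (T closure_of \<Omega>) \<and>
        S = (+) t ` projected_set L \<Omega>)"

section \<open>Diffraction\<close>

definition test_function :: "(real^'n \<Rightarrow> 'b::real_normed_vector) \<Rightarrow> bool" where
  "test_function f \<longleftrightarrow> continuous_on UNIV f \<and> compact (closure {x. f x \<noteq> 0})"

definition locally_finite_borel :: "(real^'n) measure \<Rightarrow> bool" where
  "locally_finite_borel M \<longleftrightarrow> sets M = sets borel \<and> (\<forall>K. compact K \<longrightarrow> emeasure M K < \<infinity>)"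

text \<open>
  The autocorrelation of the Dirac comb of \<open>S\<close> is the vague limit, as the radius \<open>r\<close> tends to
  infinity, of the measures \<open>(\<Sum>x y. \<delta>(x - y)) / vol (cball 0 r)\<close> with \<open>x\<close> and \<open>y\<close> ranging
  over the points of \<open>S\<close> in \<open>cball 0 r\<close>.
\<close>

definition autocorrelation_of :: "(real^'n) set \<Rightarrow> (real^'n) measure \<Rightarrow> bool" where
  "autocorrelation_of S \<gamma> \<longleftrightarrow>
     (\<forall>r. finite (S \<inter> cball 0 r)) \<and>
     locally_finite_borel \<gamma> \<and>
     (\<forall>f :: real^'n \<Rightarrow> real. test_function f \<longrightarrow>
        ((\<lambda>r. (\<Sum>x \<in> S \<inter> cball 0 r. \<Sum>y \<in> S \<inter> cball 0 r. f (x - y)) / measure lborel (cball (0 :: real^'n) r))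
           \<longlongrightarrow> (\<integral>x. f x \<partial>\<gamma>)) at_top)"

definition inverse_fourier :: "(real^'n \<Rightarrow> complex) \<Rightarrow> real^'n \<Rightarrow> complex" where
  "inverse_fourier f k = (\<integral>x. cis (2 * pi * (k \<bullet> x)) * f x \<partial>lborel)"

definition self_convolution :: "(real^'n \<Rightarrow> complex) \<Rightarrow> real^'n \<Rightarrow> complex" where
  "self_convolution f x = (\<integral>y. f y * cnj (f (y - x)) \<partial>lborel)"

text \<open>
  The Fourier transform of a possibly unbounded measure in the sense of Argabright and
  Gil de Lamadrid: \<open>\<mu>\<close> is the transform of \<open>\<gamma>\<close> if for every continuous \<open>f\<close> with compact support
  the \<open>\<gamma>\<close>-integral of \<open>f * f~\<close>, where \<open>f~ x = cnj (f (- x))\<close>, is the \<open>\<mu>\<close>-integral of the squared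
  modulus of the inverse Fourier transform of \<open>f\<close>.
\<close>

definition fourier_transform_of :: "(real^'n) measure \<Rightarrow> (real^'n) measure \<Rightarrow> bool" where
  "fourier_transform_of \<gamma> \<mu> \<longleftrightarrow>
     locally_finite_borel \<mu> \<and>
     (\<forall>f :: real^'n \<Rightarrow> complex. test_function f \<longrightarrow>
        integrable \<mu> (\<lambda>k. (norm (inverse_fourier f k))\<^sup>2) \<and>
        (\<integral>x. self_convolution f x \<partial>\<gamma>) =
          complex_of_real (\<integral>k. (norm (inverse_fourier f k))\<^sup>2 \<partial>\<mu>))"

definition pure_point_measure :: "(real^'n) measure \<Rightarrow> bool" where
  "pure_point_measure \<mu> \<longleftrightarrow> (\<exists>C. countable C \<and> emeasure \<mu> (UNIV - C) = 0)"

text \<open>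
  The autocorrelation and its Fourier transform are unique if they exist; being pure point
  diffractive includes their existence.
\<close>

definition pure_point_diffractive_set :: "(real^'n) set \<Rightarrow> bool" where
  "pure_point_diffractive_set S \<longleftrightarrow>
     (\<exists>\<gamma> \<mu>. autocorrelation_of S \<gamma> \<and> fourier_transform_of \<gamma> \<mu> \<and> pure_point_measure \<mu>)"

definition pure_point_diffractive :: "('m \<Rightarrow> (real^'n) set) \<Rightarrow> bool" where
  "pure_point_diffractive V \<longleftrightarrow> (\<forall>i. pure_point_diffractive_set (V i))"

end

theory Submission
  imports Defs
begin

text \<open>
  Since the components are disjoint, they form a colouring \<open>c\<close> of the lattice \<open>L\<close>, and
  bijectivity says that every digit \<open>d\<close> acts on the colours by a permutation:
  \<open>c (Q x + d) = \<sigma> (c x)\<close> with \<open>\<sigma>\<close> depending on \<open>d\<close> only. Consequently inflation neither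
  creates nor destroys differences of colour.

  Both properties to be refuted would make the colouring almost invariant under many translations.
  Fix \<open>z \<noteq> 0\<close> in \<open>L\<close> and consider the vectors \<open>Q\<^sup>k z\<close>. If a component is a model set, they are
  sorted into finitely many classes by covering the compact closure of the window with small
  open sets, and the difference \<open>y\<close> of two vectors of the same class maps a relatively dense
  part of the component into the component (\<open>model_set_returns\<close>). If all components are
  pure point diffractive, the diffraction measure is concentrated, up to a small error, on finitely
  many frequencies; the classes then record the phases of a vector at these frequencies, and \<open>y\<close>
  moves only a small proportion of every component out of it (\<open>pure_point_almost_periods\<close>).
  The pigeonhole principle yields such a \<open>y = Q\<^sup>M\<^sup>+\<^sup>n z - Q\<^sup>M z\<close> with \<open>n\<close> as large as needed.

  A bijective substitution contradicts this. Let \<open>a\<close> and \<open>a + z\<close> be expansions by \<open>n\<close> digits,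
  \<open>b\<close> an expansion by \<open>M\<close> digits, and \<open>w = Q\<^sup>M\<^sup>+\<^sup>n x + Q\<^sup>M (a + z) + b\<close>. Then
  \<open>w + y = Q\<^sup>M\<^sup>+\<^sup>n (x + z) + Q\<^sup>M a + b\<close>, so \<open>c w\<close> and \<open>c (w + y)\<close> arise from \<open>c x\<close> and \<open>c (x + z)\<close>
  by two permutations, and \<open>c w \<noteq> c (w + y)\<close> as soon as \<open>c (x + z) \<noteq> \<sigma> (c x)\<close> for a certain
  permutation \<open>\<sigma>\<close> that does not depend on \<open>x\<close> and \<open>b\<close>
  (\<open>permuted_shift_violates_return\<close>). Such an \<open>x\<close> exists: if \<open>c (x + z) = \<sigma> (c x)\<close> for all \<open>x\<close>,
  then some positive multiple of \<open>z\<close> is a period (\<open>shift_not_permutation\<close>).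

  For model sets this suffices: \<open>b\<close> ranges over all expansions by \<open>M\<close> digits, these contain a
  translate of every given ball of \<open>L\<close> if \<open>M\<close> is large, hence some \<open>w\<close> lies in the relatively
  dense set on which translation by \<open>y\<close> preserves the colour. For diffraction, primitivity and the
  legality of all clusters provide a suitable \<open>x\<close> in every supertile of a fixed level, so the proportion
  of points whose colour changes under \<open>y\<close> is bounded below independently of \<open>M\<close> and \<open>n\<close>
  (\<open>colour_changes_dense\<close>).
\<close>

section \<open>Lattices\<close>

text \<open>
  The sets \<open>A s\<close> project to an increasing open cover of the compact quotient, so a single one of
  them covers it. The maps \<open>g \<mapsto> l g\<close> have to be continuous because openness in the quotient is
  openness of the union of all translates of \<open>A s\<close>.
\<close>

lemma group_lattice_compact_fundamental_set:
  fixes G (structure) and A :: "nat \<Rightarrow> 'g set"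
  assumes "group G" and lat: "group_lattice G T L" and top: "topspace T = carrier G"
    and cont: "\<And>l. l \<in> L \<Longrightarrow> continuous_map T T (\<lambda>g. l \<otimes>\<^bsub>G\<^esub> g)"
    and A_open: "\<And>s. openin T (A s)" and A_mono: "mono A"
    and cover: "\<And>g. g \<in> carrier G \<Longrightarrow> \<exists>s. \<exists>l\<in>L. l \<otimes>\<^bsub>G\<^esub> g \<in> A s"
  shows "\<exists>s. \<forall>g\<in>carrier G. \<exists>l\<in>L. l \<otimes>\<^bsub>G\<^esub> g \<in> A s"
proof -
  interpret group G by fact
  have sub: "subgroup L G"
    using lat by (simp add: group_lattice_def)
  then have Lc: "L \<subseteq> carrier G"
    by (rule subgroup.subset)
  define q where "q = (\<lambda>g. L #> g)"
  obtain Y where quot: "quotient_map T Y q" and comp: "compact_space Y"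
    using lat by (auto simp: group_lattice_def q_def)
  define B where "B s = {g \<in> carrier G. \<exists>l\<in>L. l \<otimes> g \<in> A s}" for s
  have B_open: "openin T (B s)" for s
  proof -
    have "B s = (\<Union>l\<in>L. {g \<in> topspace T. l \<otimes> g \<in> A s})"
      by (auto simp: B_def top)
    moreover have "openin T {g \<in> topspace T. l \<otimes> g \<in> A s}" if "l \<in> L" for l
      using cont[OF that] A_open by (rule openin_continuous_map_preimage)
    ultimately show ?thesis by auto
  qed
  have sat: "g \<in> B s" if g: "g \<in> carrier G" and b: "b \<in> B s" and eq: "q g = q b" for g b s
  proof -
    have bc: "b \<in> carrier G" and "\<exists>l\<in>L. l \<otimes> b \<in> A s"
      using b by (auto simp: B_def)
    then obtain l where l: "l \<in> L" "l \<otimes> b \<in> A s" by auto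
    have "b \<in> L #> g"
      using rcos_self[OF bc sub] eq by (simp add: q_def)
    then obtain l' where l': "l' \<in> L" "b = l' \<otimes> g"
      by (auto simp: r_coset_def)
    have "(l \<otimes> l') \<otimes> g \<in> A s"
      using l l' Lc g by (metis m_assoc subsetD)
    then show ?thesis
      using g subgroup.m_closed[OF sub l(1) l'(1)] by (auto simp: B_def)
  qed
  have img: "openin Y (q ` B s)" for s
  proof -
    have "q ` B s \<subseteq> topspace Y"
      using quot top by (auto simp: quotient_map_def B_def)
    moreover have "{x \<in> topspace T. q x \<in> q ` B s} = B s"
    proof
      show "{x \<in> topspace T. q x \<in> q ` B s} \<subseteq> B s"
        using sat unfolding top by blast
      show "B s \<subseteq> {x \<in> topspace T. q x \<in> q ` B s}"
        unfolding top B_def by blast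
    qed
    ultimately show ?thesis
      using quot B_open[of s] unfolding quotient_map_def by metis
  qed
  have Ytop: "topspace Y = q ` carrier G"
    using quot top by (simp add: quotient_map_def)
  have "\<exists>s. g \<in> B s" if "g \<in> carrier G" for g
    using cover[OF that] that by (auto simp: B_def)
  then have "topspace Y \<subseteq> \<Union>(range (\<lambda>s. q ` B s))"
    unfolding Ytop by blast
  moreover have "openin Y U" if "U \<in> range (\<lambda>s. q ` B s)" for U
    using that img by blast
  ultimately obtain F where F: "finite F" "F \<subseteq> range (\<lambda>s. q ` B s)" "topspace Y \<subseteq> \<Union>F"
    using comp[unfolded compact_space_def] compactinD by metis
  then obtain N where N: "finite N" "F = (\<lambda>s. q ` B s) ` N"
    by (meson finite_subset_image)
  have B_mono: "B s \<subseteq> B t" if "s \<le> t" for s t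
    using monoD[OF A_mono that] by (auto simp: B_def)
  \<comment> \<open>The element 0 is inserted because the finite subcover may be empty.\<close>
  define s where "s = Max (insert 0 N)"
  have "g \<in> B s" if g: "g \<in> carrier G" for g
  proof -
    have "q g \<in> \<Union>F" using F(3) g by (auto simp: Ytop)
    then obtain t b where "t \<in> N" "b \<in> B t" "q g = q b"
      by (auto simp: N(2))
    moreover have "t \<le> s" using \<open>t \<in> N\<close> N(1) by (simp add: s_def)
    ultimately show ?thesis using sat[OF g] B_mono by blast
  qed
  then show ?thesis by (auto simp: B_def)
qed

lemma euclidean_group_simps [simp]:
  "carrier euclidean_group = UNIV" "x \<otimes>\<^bsub>euclidean_group\<^esub> y = x + y"
  "\<one>\<^bsub>euclidean_group\<^esub> = 0"
  by (simp_all add: euclidean_group_def)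

lemma comm_group_euclidean: "comm_group (euclidean_group :: (real^'n) monoid)"
  by (rule comm_groupI) (auto simp: add_ac intro: exI[of _ "- x" for x])

lemma group_euclidean: "group (euclidean_group :: (real^'n) monoid)"
  by (rule comm_group.axioms(2)[OF comm_group_euclidean])

lemma inv_euclidean [simp]: "inv\<^bsub>euclidean_group\<^esub> x = - (x :: real^'n)"
  by (rule group.inv_equality[OF group_euclidean]) auto

text \<open>
  All that the argument uses about a lattice in Euclidean space: a uniformly discrete and relatively
  dense subgroup.
\<close>

locale point_lattice =
  fixes L :: "(real^'n) set"
  assumes zero_mem: "0 \<in> L"
    and diff_mem: "x \<in> L \<Longrightarrow> y \<in> L \<Longrightarrow> x - y \<in> L"
    and separated: "\<exists>\<rho>>0. \<forall>x\<in>L. norm x < \<rho> \<longrightarrow> x = 0"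
    and relatively_dense: "\<exists>R>0. \<forall>x. \<exists>y\<in>L. norm (x - y) < R"
begin

lemma minus_mem: "x \<in> L \<Longrightarrow> - x \<in> L"
  using diff_mem[OF zero_mem] by simp

lemma add_mem: "x \<in> L \<Longrightarrow> y \<in> L \<Longrightarrow> x + y \<in> L"
  using diff_mem[of x "- y"] minus_mem[of y] by simp

lemma finite_bounded: "bounded B \<Longrightarrow> finite (L \<inter> B)"
proof -
  assume B: "bounded B"
  obtain \<rho> where \<rho>: "\<rho> > 0" "\<And>x. x \<in> L \<Longrightarrow> norm x < \<rho> \<Longrightarrow> x = 0"
    using separated by blast
  show ?thesis
  proof (rule ccontr)
    assume "infinite (L \<inter> B)"
    then obtain x where "x islimpt L \<inter> B"
      using bounded_infinite_imp_islimpt[of "L \<inter> B"] bounded_subset[OF B] by blast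
    then have "infinite (L \<inter> B \<inter> ball x (\<rho> / 2))"
      using \<rho>(1) by (simp add: islimpt_eq_infinite_ball)
    from infinite_imp_nonempty[OF this] obtain u where u: "u \<in> L" "u \<in> ball x (\<rho> / 2)"
      by auto
    have "infinite (L \<inter> B \<inter> ball x (\<rho> / 2) - {u})"
      using \<open>infinite (L \<inter> B \<inter> ball x (\<rho> / 2))\<close> by simp
    from infinite_imp_nonempty[OF this]
    obtain v where v: "v \<in> L" "v \<in> ball x (\<rho> / 2)" "v \<noteq> u"
      by blast
    have "dist u v < \<rho>"
      using u v by (metis dist_triangle_half_r mem_ball)
    then have "u - v = 0"
      using \<rho>(2)[OF diff_mem[OF u(1) v(1)]] by (simp add: dist_norm)
    with v show False by simp
  qed
qed

lemma nonzero_mem: "\<exists>z\<in>L. z \<noteq> 0"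
proof -
  obtain R where R: "R > 0" "\<And>x. \<exists>y\<in>L. norm (x - y) < R"
    using relatively_dense by blast
  obtain u :: "real^'n" where u: "norm u = R"
    using vector_choose_size[of R] R(1) by auto
  obtain y where "y \<in> L" "norm (u - y) < R" using R(2) by blast
  with u have "y \<noteq> 0" by auto
  with \<open>y \<in> L\<close> show ?thesis by blast
qed

end

lemma point_lattice_euclidean:
  assumes "euclidean_lattice L"
  shows "point_lattice L"
proof
  have lat: "group_lattice euclidean_group euclidean L"
    using assms by (simp add: euclidean_lattice_def)
  then have sub: "subgroup L euclidean_group"
    by (simp add: group_lattice_def)
  show "0 \<in> L" using subgroup.one_closed[OF sub] by simp
  show diff: "x - y \<in> L" if "x \<in> L" "y \<in> L" for x y
    using subgroup.m_closed[OF sub that(1) subgroup.m_inv_closed[OF sub that(2)]] by simp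
  show "\<exists>\<rho>>0. \<forall>x\<in>L. norm x < \<rho> \<longrightarrow> x = 0"
  proof -
    have "openin (subtopology euclidean L) {0}"
      using lat \<open>0 \<in> L\<close> by (simp add: group_lattice_def)
    then obtain U where "open U" "{0} = U \<inter> L"
      by (auto simp: openin_subtopology)
    moreover from this obtain \<rho> where "\<rho> > 0" "ball 0 \<rho> \<subseteq> U"
      by (metis Int_iff insertI1 open_contains_ball)
    ultimately show ?thesis
      by (intro exI[of _ \<rho>]) (auto simp: subset_iff)
  qed
  have "\<exists>s. \<forall>g\<in>carrier euclidean_group. \<exists>l\<in>L. l \<otimes>\<^bsub>euclidean_group\<^esub> g \<in> ball 0 (real s)"
  proof (rule group_lattice_compact_fundamental_set[OF group_euclidean lat])
    show "\<exists>s. \<exists>l\<in>L. l \<otimes>\<^bsub>euclidean_group\<^esub> g \<in> ball 0 (real s)" for g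
      using \<open>0 \<in> L\<close> reals_Archimedean2[of "norm g"] by (force intro: bexI[of _ 0])
    show "mono (\<lambda>s. ball 0 (real s))" by (auto simp: mono_def)
  qed (auto intro!: continuous_intros)
  then obtain s where s: "\<And>g. \<exists>l\<in>L. norm (l + g) < real s" by auto
  have "real s > 0" using s[of 0] norm_ge_zero le_less_trans by blast
  moreover have "\<exists>y\<in>L. norm (x - y) < real s" for x
    using s[of x] diff[OF \<open>0 \<in> L\<close>] by (metis add.commute diff_0 diff_minus_eq_add)
  ultimately show "\<exists>R>0. \<forall>x. \<exists>y\<in>L. norm (x - y) < R" by blast
qed

section \<open>Return vectors of model sets\<close>

lemma continuous_map_prod_nbhds:
  assumes "continuous_map (prod_topology X Y) Z (\<lambda>(x, y). f x y)" and "openin Z W"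
    and "a \<in> topspace X" "b \<in> topspace Y" "f a b \<in> W"
  shows "\<exists>U V. openin X U \<and> openin Y V \<and> a \<in> U \<and> b \<in> V \<and> (\<forall>x\<in>U. \<forall>y\<in>V. f x y \<in> W)"
proof -
  let ?P = "{p \<in> topspace (prod_topology X Y). (case p of (x, y) \<Rightarrow> f x y) \<in> W}"
  have "openin (prod_topology X Y) ?P"
    using assms(1,2) by (rule openin_continuous_map_preimage)
  moreover have "(a, b) \<in> ?P" using assms(3-) by simp
  ultimately have "\<exists>U V. openin X U \<and> openin Y V \<and> a \<in> U \<and> b \<in> V \<and> U \<times> V \<subseteq> ?P"
    by (rule openin_prod_topology_alt[THEN iffD1, rule_format])
  then obtain U V where "openin X U" "openin Y V" "a \<in> U" "b \<in> V" and sub: "U \<times> V \<subseteq> ?P"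
    by (elim exE conjE)
  moreover have "f x y \<in> W" if "x \<in> U" "y \<in> V" for x y
    using subsetD[OF sub, of "(x, y)"] that by simp
  ultimately show ?thesis by (intro exI[of _ U] exI[of _ V]) simp
qed

context
  fixes H :: "'h monoid" and T :: "'h topology" and \<Lambda> :: "((real^'n) \<times> 'h) set"
  assumes cps: "cut_and_project_scheme H T \<Lambda>"
begin

interpretation H: comm_group H
  using cps by (simp add: cut_and_project_scheme_def lca_group_def)

interpretation P: group "euclidean_group \<times>\<times> H"
  by (rule DirProd_group[OF group_euclidean H.group_axioms])

lemma internal_topspace: "topspace T = carrier H"
  using cps by (simp add: cut_and_project_scheme_def lca_group_def)

lemma internal_lattice_subgroup: "subgroup \<Lambda> (euclidean_group \<times>\<times> H)"
  using cps by (simp add: cut_and_project_scheme_def group_lattice_def)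

lemma internal_lattice_snd: "l \<in> \<Lambda> \<Longrightarrow> snd l \<in> carrier H"
  using subgroup.subset[OF internal_lattice_subgroup] by (auto simp: DirProd_def)

lemma internal_lattice_diff:
  assumes "l \<in> \<Lambda>" "l' \<in> \<Lambda>"
  shows "(fst l - fst l', snd l \<otimes>\<^bsub>H\<^esub> inv\<^bsub>H\<^esub> snd l') \<in> \<Lambda>"
proof -
  have "inv\<^bsub>euclidean_group \<times>\<times> H\<^esub> l' = (- fst l', inv\<^bsub>H\<^esub> snd l')"
    using inv_DirProd[OF group_euclidean H.group_axioms, of "fst l'" "snd l'"]
      internal_lattice_snd[OF assms(2)] by simp
  then show ?thesis
    using subgroup.m_closed[OF internal_lattice_subgroup assms(1)
        subgroup.m_inv_closed[OF internal_lattice_subgroup assms(2)]]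
    by (simp add: mult_DirProd')
qed

lemma internal_lattice_add:
  assumes "l \<in> \<Lambda>" "l' \<in> \<Lambda>"
  shows "(fst l + fst l', snd l \<otimes>\<^bsub>H\<^esub> snd l') \<in> \<Lambda>"
  using subgroup.m_closed[OF internal_lattice_subgroup assms] by (simp add: mult_DirProd')

lemma continuous_internal_mult: "continuous_map (prod_topology T T) T (\<lambda>(x, y). x \<otimes>\<^bsub>H\<^esub> y)"
  using cps by (simp add: cut_and_project_scheme_def lca_group_def)

lemma continuous_internal_inv: "continuous_map T T (\<lambda>x. inv\<^bsub>H\<^esub> x)"
  using cps by (simp add: cut_and_project_scheme_def lca_group_def)

lemma continuous_internal_mult_left:
  assumes "h \<in> carrier H"
  shows "continuous_map T T (\<lambda>x. h \<otimes>\<^bsub>H\<^esub> x)"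
proof -
  have "continuous_map T (prod_topology T T) (\<lambda>x. (h, x))"
    using assms by (simp add: continuous_map_pairedI internal_topspace)
  from continuous_map_compose[OF this continuous_internal_mult] show ?thesis
    by (simp add: comp_def)
qed

lemma continuous_internal_divide:
  "continuous_map (prod_topology T T) T (\<lambda>(x, y). x \<otimes>\<^bsub>H\<^esub> inv\<^bsub>H\<^esub> y)"
proof -
  have "continuous_map (prod_topology T T) (prod_topology T T) (\<lambda>p. (fst p, inv\<^bsub>H\<^esub> snd p))"
    by (intro continuous_map_pairedI continuous_map_fst
        continuous_map_compose[OF continuous_map_snd continuous_internal_inv, unfolded comp_def])
  from continuous_map_compose[OF this continuous_internal_mult] show ?thesis
    by (simp add: comp_def case_prod_unfold)
qed

text \<open>
  Density of the star image, applied to the translate of \<open>U\<close> by the inverse of \<open>h\<close>.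
\<close>

lemma window_hit:
  assumes U: "openin T U" "U \<noteq> {}" and h: "h \<in> carrier H"
  shows "\<exists>l\<in>\<Lambda>. snd l \<otimes>\<^bsub>H\<^esub> h \<in> U"
proof -
  let ?W = "{x \<in> topspace T. x \<otimes>\<^bsub>H\<^esub> h \<in> U}"
  have "continuous_map T T (\<lambda>x. x \<otimes>\<^bsub>H\<^esub> h)"
    by (rule continuous_map_eq[OF continuous_internal_mult_left[OF h]])
      (simp add: internal_topspace H.m_comm h)
  then have W: "openin T ?W"
    using U(1) by (rule openin_continuous_map_preimage)
  obtain u where u: "u \<in> U" "u \<in> carrier H"
    using U openin_subset[OF U(1)] by (auto simp: internal_topspace)
  have "u \<otimes>\<^bsub>H\<^esub> inv\<^bsub>H\<^esub> h \<otimes>\<^bsub>H\<^esub> h = u"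
    using u h by (simp add: H.m_assoc)
  then have "u \<otimes>\<^bsub>H\<^esub> inv\<^bsub>H\<^esub> h \<in> ?W"
    using u h by (simp add: internal_topspace)
  moreover have "T closure_of (snd ` \<Lambda>) = topspace T"
    using cps by (simp add: cut_and_project_scheme_def)
  ultimately have "snd ` \<Lambda> \<inter> ?W \<noteq> {}"
    using W dense_intersects_open[of T "snd ` \<Lambda>"] by blast
  then show ?thesis by auto
qed

text \<open>
  By density of \<open>snd ` \<Lambda>\<close>, every point of the product can be moved by \<open>\<Lambda>\<close> into \<open>ball 0 s \<times> U\<close> for
  some \<open>s\<close>. Compactness of the quotient makes \<open>s\<close> uniform, and the points \<open>(- x, \<one>)\<close> then give
  the claim.
\<close>

lemma projected_set_relatively_dense:
  assumes U: "openin T U" "U \<noteq> {}"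
  shows "\<exists>R>0. \<forall>x. \<exists>y\<in>projected_set \<Lambda> U. norm (x - y) < R"
proof -
  define A where "A s = ball (0 :: real^'n) (real s) \<times> U" for s
  have "\<exists>s. \<forall>g\<in>carrier (euclidean_group \<times>\<times> H). \<exists>l\<in>\<Lambda>. l \<otimes>\<^bsub>euclidean_group \<times>\<times> H\<^esub> g \<in> A s"
  proof (rule group_lattice_compact_fundamental_set[OF P.is_group])
    show "group_lattice (euclidean_group \<times>\<times> H) (prod_topology euclidean T) \<Lambda>"
      using cps by (simp add: cut_and_project_scheme_def)
    show "topspace (prod_topology euclidean T) = carrier (euclidean_group \<times>\<times> H)"
      by (simp add: internal_topspace DirProd_def)
    show "continuous_map (prod_topology euclidean T) (prod_topology euclidean T)
        (\<lambda>g. l \<otimes>\<^bsub>euclidean_group \<times>\<times> H\<^esub> g)" if "l \<in> \<Lambda>" for l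
    proof -
      have 1: "continuous_map euclidean euclidean (\<lambda>x. fst l + x)"
        by (simp add: continuous_intros)
      have "continuous_map (prod_topology euclidean T) (prod_topology euclidean T)
          (\<lambda>g. (fst l + fst g, snd l \<otimes>\<^bsub>H\<^esub> snd g))"
        by (intro continuous_map_pairedI
            continuous_map_compose[OF continuous_map_fst 1, unfolded comp_def]
            continuous_map_compose[OF continuous_map_snd
              continuous_internal_mult_left[OF internal_lattice_snd[OF that]], unfolded comp_def])
      then show ?thesis by (simp add: mult_DirProd')
    qed
    show "openin (prod_topology euclidean T) (A s)" for s
      unfolding A_def using U(1) by (simp add: openin_prod_Times_iff)
    show "mono A" by (auto simp: A_def mono_def)
    show "\<exists>s. \<exists>l\<in>\<Lambda>. l \<otimes>\<^bsub>euclidean_group \<times>\<times> H\<^esub> g \<in> A s"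
      if "g \<in> carrier (euclidean_group \<times>\<times> H)" for g
    proof -
      have g: "snd g \<in> carrier H" using that by (auto simp: DirProd_def)
      then obtain l where l: "l \<in> \<Lambda>" "snd l \<otimes>\<^bsub>H\<^esub> snd g \<in> U"
        using window_hit[OF U] by blast
      obtain s where "norm (fst l + fst g) < real s" using reals_Archimedean2 by blast
      then have "l \<otimes>\<^bsub>euclidean_group \<times>\<times> H\<^esub> g \<in> A s"
        using l by (simp add: A_def mult_DirProd')
      with l show ?thesis by blast
    qed
  qed
  then obtain s where s: "\<And>g. g \<in> carrier (euclidean_group \<times>\<times> H) \<Longrightarrow>
      \<exists>l\<in>\<Lambda>. l \<otimes>\<^bsub>euclidean_group \<times>\<times> H\<^esub> g \<in> A s" by blast
  have near: "\<exists>y\<in>projected_set \<Lambda> U. norm (x - y) < real s" for x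
  proof -
    have "(- x, \<one>\<^bsub>H\<^esub>) \<in> carrier (euclidean_group \<times>\<times> H)" by (simp add: DirProd_def)
    from s[OF this] obtain l where l: "l \<in> \<Lambda>" "norm (fst l - x) < real s" "snd l \<in> U"
      using internal_lattice_snd by (auto simp: A_def mult_DirProd')
    then have "fst l \<in> projected_set \<Lambda> U" unfolding projected_set_def by blast
    with l(2) show ?thesis by (metis norm_minus_commute)
  qed
  moreover have "real s > 0" using near[of 0] norm_ge_zero le_less_trans by blast
  ultimately show ?thesis by blast
qed

text \<open>
  A finite cover of \<open>C\<close> by open sets whose difference sets lie in \<open>W\<close>; \<open>\<kappa>\<close> selects a member
  of the cover, named by its centre.
\<close>

lemma compact_internal_colouring:
  assumes C: "compactin T C" and W: "openin T W" "\<one>\<^bsub>H\<^esub> \<in> W"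
  shows "\<exists>\<kappa>. finite (\<kappa> ` C) \<and> (\<forall>g\<in>C. \<forall>h\<in>C. \<kappa> g = (\<kappa> h :: 'h) \<longrightarrow> g \<otimes>\<^bsub>H\<^esub> inv\<^bsub>H\<^esub> h \<in> W)"
proof -
  have Cc: "C \<subseteq> carrier H" using compactin_subset_topspace[OF C] by (simp add: internal_topspace)
  have "\<exists>O'. openin T O' \<and> h \<in> O' \<and> (\<forall>a\<in>O'. \<forall>b\<in>O'. a \<otimes>\<^bsub>H\<^esub> inv\<^bsub>H\<^esub> b \<in> W)" if "h \<in> C" for h
  proof -
    have "h \<in> topspace T" "h \<otimes>\<^bsub>H\<^esub> inv\<^bsub>H\<^esub> h \<in> W"
      using that Cc W(2) by (auto simp: internal_topspace)
    from continuous_map_prod_nbhds[OF continuous_internal_divide W(1) this(1,1,2)]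
    obtain O1 O2 where "openin T O1" "openin T O2" "h \<in> O1" "h \<in> O2"
        "\<forall>a\<in>O1. \<forall>b\<in>O2. a \<otimes>\<^bsub>H\<^esub> inv\<^bsub>H\<^esub> b \<in> W" by blast
    then show ?thesis by (intro exI[of _ "O1 \<inter> O2"]) (auto intro: openin_Int)
  qed
  then obtain N where N: "\<And>h. h \<in> C \<Longrightarrow> openin T (N h)" "\<And>h. h \<in> C \<Longrightarrow> h \<in> N h"
      "\<And>h a b. h \<in> C \<Longrightarrow> a \<in> N h \<Longrightarrow> b \<in> N h \<Longrightarrow> a \<otimes>\<^bsub>H\<^esub> inv\<^bsub>H\<^esub> b \<in> W" by metis
  have "\<exists>\<F>. finite \<F> \<and> \<F> \<subseteq> N ` C \<and> C \<subseteq> \<Union>\<F>"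
    using N by (intro compactinD[OF C]) auto
  then obtain F where F: "finite F" "F \<subseteq> C" "C \<subseteq> \<Union>(N ` F)"
    by (metis finite_subset_image)
  then have "\<exists>h. h \<in> F \<and> g \<in> N h" if "g \<in> C" for g using that by blast
  then obtain \<kappa> where \<kappa>: "\<And>g. g \<in> C \<Longrightarrow> \<kappa> g \<in> F \<and> g \<in> N (\<kappa> g)" by metis
  have "g \<otimes>\<^bsub>H\<^esub> inv\<^bsub>H\<^esub> h \<in> W" if "g \<in> C" "h \<in> C" "\<kappa> g = \<kappa> h" for g h
    using N(3)[of "\<kappa> g" g h] \<kappa>[OF that(1)] \<kappa>[OF that(2)] that(3) F(2) by auto
  moreover have "finite (\<kappa> ` C)" using \<kappa> F(1) by (auto intro: finite_subset)
  ultimately show ?thesis by blast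
qed

end

text \<open>
  The set \<open>S'\<close> comes from a smaller window \<open>U'\<close> with \<open>U' W \<subseteq> U\<close>, where \<open>U\<close> is the interior of the
  window and \<open>W\<close> a neighbourhood of the identity. A vector \<open>y\<close> of \<open>L\<close> need not have a star image,
  since only points of \<open>\<Lambda>\<close> have one. It is therefore approximated by a point \<open>l y\<close> of \<open>\<Lambda>\<close> with star
  image in \<open>U'\<close>. The class of \<open>y\<close> consists of the error of approximation, which takes finitely many
  values in \<open>L\<close>, and of a small open set around the star image. For equal classes the errors cancel, and
  \<open>y - y'\<close> has a star image in \<open>W\<close>.
\<close>

theorem model_set_returns:
  fixes L :: "(real^'n) set"
  assumes "point_lattice L" and "model_set TYPE('h) S" and "S \<subseteq> L"
  shows "\<exists>S' R (\<kappa> :: real^'n \<Rightarrow> (real^'n) \<times> 'h). R > 0 \<and> (\<forall>x. \<exists>w\<in>S'. norm (x - w) < R) \<and>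
    S' \<subseteq> S \<and> finite (\<kappa> ` L) \<and>
    (\<forall>y\<in>L. \<forall>y'\<in>L. \<kappa> y = \<kappa> y' \<longrightarrow> (\<forall>w\<in>S'. w + (y - y') \<in> S))"
proof -
  interpret point_lattice L by fact
  obtain H :: "'h monoid" and T \<Lambda> \<Omega> t where cps: "cut_and_project_scheme H T \<Lambda>"
    and \<Omega>: "T interior_of \<Omega> \<noteq> {}" "compactin T (T closure_of \<Omega>)" "\<Omega> \<subseteq> carrier H"
    and S: "S = (+) t ` projected_set \<Lambda> \<Omega>"
    using assms(2) unfolding model_set_def by (elim exE conjE) (rule that)
  interpret H: comm_group H
    using cps by (simp add: cut_and_project_scheme_def lca_group_def)
  define U where "U = T interior_of \<Omega>"
  have U: "openin T U" "U \<noteq> {}" "U \<subseteq> \<Omega>"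
    using \<Omega> by (auto simp: U_def interior_of_subset)
  have "U \<subseteq> T closure_of \<Omega>"
    using U(3) closure_of_subset[of \<Omega> T] \<Omega>(3) by (simp add: internal_topspace[OF cps])
  obtain p where p: "p \<in> U" "p \<in> carrier H" using U \<Omega>(3) by blast
  have "p \<in> topspace T" "\<one>\<^bsub>H\<^esub> \<in> topspace T" "p \<otimes>\<^bsub>H\<^esub> \<one>\<^bsub>H\<^esub> \<in> U"
    using p by (simp_all add: internal_topspace[OF cps])
  from continuous_map_prod_nbhds[OF continuous_internal_mult[OF cps] U(1) this]
  obtain U' W where U': "openin T U'" "p \<in> U'" and W: "openin T W" "\<one>\<^bsub>H\<^esub> \<in> W"
    and UW: "\<And>u w. u \<in> U' \<Longrightarrow> w \<in> W \<Longrightarrow> u \<otimes>\<^bsub>H\<^esub> w \<in> U"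
    by blast
  have U'U: "U' \<subseteq> U"
  proof
    fix u assume u: "u \<in> U'"
    then have "u \<in> carrier H" using openin_subset[OF U'(1)] by (auto simp: internal_topspace[OF cps])
    then show "u \<in> U" using UW[OF u W(2)] by simp
  qed
  define S' where "S' = (+) t ` projected_set \<Lambda> U'"
  obtain R where R: "R > 0" "\<And>x. \<exists>y\<in>projected_set \<Lambda> U'. norm (x - y) < R"
    using projected_set_relatively_dense[OF cps U'(1)] U'(2) by blast
  have dense: "\<exists>w\<in>S'. norm (x - w) < R" for x
    using R(2)[of "x - t"] by (auto simp: S'_def algebra_simps)
  have "S' \<subseteq> S"
    using U'U U(3) by (auto simp: S S'_def projected_set_def)
  have "\<exists>l\<in>\<Lambda>. snd l \<in> U' \<and> norm (y - fst l) < R" for y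
    using R(2)[of y] unfolding projected_set_def by blast
  then obtain l where l: "\<And>y. l y \<in> \<Lambda>" "\<And>y. snd (l y) \<in> U'" "\<And>y. norm (y - fst (l y)) < R" by metis
  obtain \<kappa> :: "'h \<Rightarrow> 'h" where \<kappa>: "finite (\<kappa> ` (T closure_of \<Omega>))"
      "\<And>g h. g \<in> T closure_of \<Omega> \<Longrightarrow> h \<in> T closure_of \<Omega> \<Longrightarrow> \<kappa> g = \<kappa> h \<Longrightarrow> g \<otimes>\<^bsub>H\<^esub> inv\<^bsub>H\<^esub> h \<in> W"
    using compact_internal_colouring[OF cps \<Omega>(2) W] by blast
  have lC: "snd (l y) \<in> T closure_of \<Omega>" for y
    using l(2) U'U \<open>U \<subseteq> T closure_of \<Omega>\<close> by blast
  \<comment> \<open>the error of the approximation of \<open>y\<close>, and the small open set around the star image\<close>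
  define \<kappa>' where "\<kappa>' y = (y - (t + fst (l y)), \<kappa> (snd (l y)))" for y
  have "\<kappa>' ` L \<subseteq> (L \<inter> cball 0 (R + norm t)) \<times> \<kappa> ` (T closure_of \<Omega>)"
  proof (rule image_subsetI)
    fix y assume y: "y \<in> L"
    have "t + fst (l y) \<in> S'" unfolding S'_def projected_set_def using l by blast
    then have "y - (t + fst (l y)) \<in> L" using y \<open>S' \<subseteq> S\<close> assms(3) by (intro diff_mem) auto
    moreover have "norm (y - (t + fst (l y))) \<le> R + norm t"
      using norm_triangle_ineq4[of "y - fst (l y)" t] l(3)[of y] by (simp add: algebra_simps)
    ultimately show "\<kappa>' y \<in> (L \<inter> cball 0 (R + norm t)) \<times> \<kappa> ` (T closure_of \<Omega>)"
      using lC by (simp add: \<kappa>'_def)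
  qed
  then have fin: "finite (\<kappa>' ` L)"
    by (rule finite_subset) (intro finite_cartesian_product finite_bounded bounded_cball \<kappa>(1))
  have ret: "w + (y - y') \<in> S" if same: "\<kappa>' y = \<kappa>' y'" and w: "w \<in> S'" for y y' w
  proof -
    have y: "y - y' = fst (l y) - fst (l y')" and eq: "\<kappa> (snd (l y)) = \<kappa> (snd (l y'))"
      using same by (auto simp: \<kappa>'_def algebra_simps)
    obtain m where m: "m \<in> \<Lambda>" "snd m \<in> U'" "w = t + fst m"
      using w by (auto simp: S'_def projected_set_def)
    define \<delta> where "\<delta> = snd (l y) \<otimes>\<^bsub>H\<^esub> inv\<^bsub>H\<^esub> snd (l y')"
    have "\<delta> \<in> W" using \<kappa>(2)[OF lC lC eq] by (simp add: \<delta>_def)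
    then have "snd m \<otimes>\<^bsub>H\<^esub> \<delta> \<in> \<Omega>" using UW[OF m(2)] U(3) by blast
    moreover have "(fst m + (y - y'), snd m \<otimes>\<^bsub>H\<^esub> \<delta>) \<in> \<Lambda>"
      using internal_lattice_add[OF cps m(1) internal_lattice_diff[OF cps l(1) l(1)]]
      by (simp add: \<delta>_def y)
    ultimately have "fst m + (y - y') \<in> projected_set \<Lambda> \<Omega>"
      by (force simp: projected_set_def)
    then show ?thesis by (auto simp: S m(3) add.assoc)
  qed
  show ?thesis
    by (rule exI[of _ S'], rule exI[of _ R], rule exI[of _ \<kappa>'])
      (simp add: R(1) dense \<open>S' \<subseteq> S\<close> fin ret)
qed

section \<open>Almost periods of pure point diffractive sets\<close>

lemma integral_lborel_translate:
  fixes f :: "'a::euclidean_space \<Rightarrow> 'b::{banach, second_countable_topology}"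
  assumes "f \<in> borel_measurable borel"
  shows "(\<integral>x. f (a + x) \<partial>lborel) = (\<integral>x. f x \<partial>lborel)"
  using integral_distr[of "(+) a" lborel borel f] assms by (simp add: lborel_distr_plus)

lemma test_functionI:
  assumes "continuous_on UNIV f" and "\<And>x. f x \<noteq> 0 \<Longrightarrow> norm x \<le> r"
  shows "test_function f"
proof -
  have "closure {x. f x \<noteq> 0} \<subseteq> cball 0 r"
    using assms(2) by (intro closure_minimal) auto
  then have "compact (closure {x. f x \<noteq> 0})"
    using bounded_subset[OF bounded_cball] by (auto simp: compact_eq_bounded_closed)
  with assms(1) show ?thesis by (simp add: test_function_def)
qed

lemma integrable_test_function:
  fixes f :: "real^'n \<Rightarrow> 'b::{banach, second_countable_topology}"
  assumes "test_function f"
  shows "integrable lborel f"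
proof -
  let ?K = "closure {x. f x \<noteq> 0}"
  have "integrable lborel (\<lambda>x. indicator ?K x *\<^sub>R f x)"
    using assms by (intro borel_integrable_compact) (auto simp: test_function_def intro: continuous_on_subset)
  also have "(\<lambda>x. indicator ?K x *\<^sub>R f x) = f"
    using closure_subset[of "{x. f x \<noteq> 0}"] by (auto simp: indicator_def fun_eq_iff)
  finally show ?thesis .
qed

definition bump :: "real \<Rightarrow> real^'n \<Rightarrow> real" where
  "bump \<rho> x = max 0 (\<rho> - norm x)"

lemma continuous_bump [continuous_intros]:
  "continuous_on S g \<Longrightarrow> continuous_on S (\<lambda>x. bump \<rho> (g x))"
  unfolding bump_def by (intro continuous_intros)

lemma bump_nonneg: "0 \<le> bump \<rho> x"
  by (simp add: bump_def)

lemma bump_support: "bump \<rho> x \<noteq> 0 \<Longrightarrow> norm x < \<rho>"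
  by (auto simp: bump_def max_def split: if_splits)

lemma bump_lipschitz: "\<bar>bump \<rho> x - bump \<rho> y\<bar> \<le> norm (x - y)"
  unfolding bump_def using norm_triangle_ineq3[of x y] by linarith

lemma borel_measurable_bump [measurable]: "bump \<rho> \<in> borel_measurable borel"
  by (intro borel_measurable_continuous_onI continuous_intros)

lemma test_function_bump_times:
  fixes h :: "real^'n \<Rightarrow> 'b::real_normed_field"
  assumes "continuous_on UNIV h"
  shows "test_function (\<lambda>u. h u * of_real (bump \<rho> u))"
proof (rule test_functionI)
  show "continuous_on UNIV (\<lambda>u. h u * of_real (bump \<rho> u))"
    using assms by (intro continuous_intros)
  show "norm u \<le> \<rho>" if "h u * of_real (bump \<rho> u) \<noteq> 0" for u
    using that bump_support[of \<rho> u] by auto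
qed

definition bump_correlation :: "real \<Rightarrow> real^'n \<Rightarrow> real" where
  "bump_correlation \<rho> x = (\<integral>u. bump \<rho> u * bump \<rho> (u - x) \<partial>lborel)"

lemma integrable_bump_product:
  "integrable lborel (\<lambda>u. bump \<rho> (u - a) * bump \<rho> (u - b))"
proof (rule integrable_test_function, rule test_functionI)
  show "continuous_on UNIV (\<lambda>u. bump \<rho> (u - a) * bump \<rho> (u - b))"
    by (intro continuous_intros)
  show "norm u \<le> \<rho> + norm a" if "bump \<rho> (u - a) * bump \<rho> (u - b) \<noteq> 0" for u
    using that bump_support[of \<rho> "u - a"] norm_triangle_sub[of u a] by fastforce
qed

lemma bump_correlation_translate:
  "(\<integral>u. bump \<rho> (u - a) * bump \<rho> (u - b) \<partial>lborel) = bump_correlation \<rho> (b - a)"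
proof -
  have "bump_correlation \<rho> (b - a) = (\<integral>u. bump \<rho> (- a + u) * bump \<rho> (- a + u - (b - a)) \<partial>lborel)"
    unfolding bump_correlation_def by (rule integral_lborel_translate[symmetric]) simp
  then show ?thesis by simp
qed

lemma bump_correlation_zero_pos:
  assumes "\<rho> > 0"
  shows "bump_correlation \<rho> (0 :: real^'n) > 0"
proof -
  let ?B = "cball (0 :: real^'n) (\<rho> / 2)"
  have "0 < (\<rho> / 2)\<^sup>2 * measure lborel ?B"
    using assms content_cball_pos[of "\<rho> / 2" "0 :: real^'n"] by simp
  also have "\<dots> = (\<integral>u. (\<rho> / 2)\<^sup>2 * indicator ?B u \<partial>lborel)"
    by simp
  also have "\<dots> \<le> bump_correlation \<rho> (0 :: real^'n)"
    unfolding bump_correlation_def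
  proof (rule integral_mono)
    show "integrable lborel (\<lambda>u. bump \<rho> u * bump \<rho> (u - 0 :: real^'n))"
      using integrable_bump_product[of \<rho> 0 0] by simp
    show "integrable lborel (\<lambda>u :: real^'n. (\<rho> / 2)\<^sup>2 * indicator ?B u)"
      using emeasure_lborel_cball_finite by (intro integrable_mult_right integrable_real_indicator) auto
    show "(\<rho> / 2)\<^sup>2 * indicator ?B u \<le> bump \<rho> u * bump \<rho> (u - 0)" for u :: "real^'n"
    proof (cases "u \<in> ?B")
      case True
      then have "norm u \<le> \<rho> / 2" by simp
      then have "\<rho> / 2 \<le> bump \<rho> u" unfolding bump_def by linarith
      then have "(\<rho> / 2) * (\<rho> / 2) \<le> bump \<rho> u * bump \<rho> u"
        using assms by (intro mult_mono) auto
      then show ?thesis using True by (simp add: power2_eq_square)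
    qed (simp add: bump_nonneg)
  qed
  finally show ?thesis .
qed

lemma bump_correlation_support:
  assumes "2 * \<rho> \<le> norm x"
  shows "bump_correlation \<rho> x = 0"
proof -
  have zero: "bump \<rho> u * bump \<rho> (u - x) = 0" for u
  proof (rule ccontr)
    assume "bump \<rho> u * bump \<rho> (u - x) \<noteq> 0"
    then have "norm u < \<rho>" "norm (u - x) < \<rho>" by (auto dest: bump_support)
    then show False using assms norm_triangle_ineq4[of u "u - x"] by simp
  qed
  show ?thesis unfolding bump_correlation_def zero by simp
qed

text \<open>
  Continuity is needed because the autocorrelation is only tested against continuous functions.
\<close>

lemma continuous_bump_correlation:
  "continuous_on UNIV (bump_correlation \<rho> :: real^'n \<Rightarrow> real)"
proof -
  define B where "B = (\<integral>u. bump \<rho> u \<partial>(lborel :: (real^'n) measure))"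
  have int: "integrable lborel (bump \<rho> :: real^'n \<Rightarrow> real)"
    using integrable_test_function[OF test_function_bump_times[of "\<lambda>_. 1 :: real" \<rho>]] by simp
  have "\<bar>bump_correlation \<rho> x - bump_correlation \<rho> y\<bar> \<le> B * norm (x - y)" for x y :: "real^'n"
  proof -
    have "bump_correlation \<rho> x - bump_correlation \<rho> y =
        (\<integral>u. bump \<rho> u * bump \<rho> (u - x) - bump \<rho> u * bump \<rho> (u - y) \<partial>lborel)"
      unfolding bump_correlation_def
      using integrable_bump_product[of \<rho> 0 x] integrable_bump_product[of \<rho> 0 y]
      by (simp add: Bochner_Integration.integral_diff)
    also have "\<bar>\<dots>\<bar> \<le> (\<integral>u. \<bar>bump \<rho> u * bump \<rho> (u - x) - bump \<rho> u * bump \<rho> (u - y)\<bar> \<partial>lborel)"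
      by (rule integral_abs_bound)
    also have "\<dots> \<le> (\<integral>u. bump \<rho> (u :: real^'n) * norm (x - y) \<partial>lborel)"
    proof (rule integral_mono)
      show "integrable lborel (\<lambda>u. \<bar>bump \<rho> u * bump \<rho> (u - x) - bump \<rho> u * bump \<rho> (u - y)\<bar>)"
        using integrable_bump_product[of \<rho> 0 x] integrable_bump_product[of \<rho> 0 y] by simp
      show "integrable lborel (\<lambda>u :: real^'n. bump \<rho> u * norm (x - y))" using int by simp
      show "\<bar>bump \<rho> u * bump \<rho> (u - x) - bump \<rho> u * bump \<rho> (u - y)\<bar> \<le> bump \<rho> u * norm (x - y)" for u
      proof -
        have "\<bar>bump \<rho> u * bump \<rho> (u - x) - bump \<rho> u * bump \<rho> (u - y)\<bar> =
            bump \<rho> u * \<bar>bump \<rho> (u - x) - bump \<rho> (u - y)\<bar>"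
          using bump_nonneg[of \<rho> u] by (simp add: abs_mult flip: right_diff_distrib)
        also have "\<dots> \<le> bump \<rho> u * norm (x - y)"
          using bump_lipschitz[of \<rho> "u - x" "u - y"] bump_nonneg[of \<rho> u]
          by (intro mult_left_mono) (simp_all add: norm_minus_commute)
        finally show ?thesis .
      qed
    qed
    finally show ?thesis by (simp add: B_def)
  qed
  moreover have "B \<ge> 0" unfolding B_def by (intro integral_nonneg_AE) (simp add: bump_nonneg)
  ultimately have "B-lipschitz_on UNIV (bump_correlation \<rho> :: real^'n \<Rightarrow> real)"
    by (intro lipschitz_onI) (simp_all add: dist_norm)
  then show ?thesis by (rule lipschitz_on_continuous_on)
qed

definition bump_difference :: "real \<Rightarrow> real^'n \<Rightarrow> real^'n \<Rightarrow> real" where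
  "bump_difference \<rho> y u = bump \<rho> u - bump \<rho> (u - y)"

text \<open>
  The autocorrelation function of \<open>bump_difference \<rho> y\<close>, see \<open>self_convolution_bump_difference\<close>.
\<close>

definition difference_correlation :: "real \<Rightarrow> real^'n \<Rightarrow> real^'n \<Rightarrow> real" where
  "difference_correlation \<rho> y x =
    2 * bump_correlation \<rho> x - bump_correlation \<rho> (x + y) - bump_correlation \<rho> (x - y)"

lemma test_function_bump_difference:
  "test_function (\<lambda>u. complex_of_real (bump_difference \<rho> y u))"
proof (rule test_functionI)
  show "continuous_on UNIV (\<lambda>u. complex_of_real (bump_difference \<rho> y u))"
    unfolding bump_difference_def by (intro continuous_intros)
  show "norm u \<le> \<rho> + norm y" if "complex_of_real (bump_difference \<rho> y u) \<noteq> 0" for u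
  proof -
    have "bump \<rho> u \<noteq> 0 \<or> bump \<rho> (u - y) \<noteq> 0" using that by (auto simp: bump_difference_def)
    then show ?thesis
      using bump_support[of \<rho> u] bump_support[of \<rho> "u - y"] norm_triangle_sub[of u y] norm_ge_zero[of y]
      by linarith
  qed
qed

lemma test_function_difference_correlation: "test_function (difference_correlation \<rho> y)"
proof (rule test_functionI)
  show "continuous_on UNIV (difference_correlation \<rho> y)"
    unfolding difference_correlation_def
    by (intro continuous_intros continuous_on_compose2[OF continuous_bump_correlation]) auto
  show "norm x \<le> 2 * \<rho> + norm y" if "difference_correlation \<rho> y x \<noteq> 0" for x
  proof (rule ccontr)
    assume "\<not> norm x \<le> 2 * \<rho> + norm y"
    then have far: "2 * \<rho> + norm y < norm x" by simp
    have "2 * \<rho> \<le> norm x"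
      using far norm_ge_zero[of y] by linarith
    moreover have "2 * \<rho> \<le> norm (x + y)"
      using far norm_triangle_ineq4[of "x + y" y] by simp
    moreover have "2 * \<rho> \<le> norm (x - y)"
      using far norm_triangle_sub[of x y] by simp
    ultimately show False using that by (simp add: difference_correlation_def bump_correlation_support)
  qed
qed

lemma self_convolution_bump_difference:
  fixes x y :: "real^'n"
  shows "self_convolution (\<lambda>u. complex_of_real (bump_difference \<rho> y u)) x =
    complex_of_real (difference_correlation \<rho> y x)"
proof -
  have int: "integrable lborel (\<lambda>u. bump \<rho> (u - a) * bump \<rho> (u - b))" for a b :: "real^'n"
    by (rule integrable_bump_product)
  have "(\<integral>u. bump_difference \<rho> y u * bump_difference \<rho> y (u - x) \<partial>lborel) =
      (\<integral>u. (bump \<rho> (u - 0) * bump \<rho> (u - x) - bump \<rho> (u - 0) * bump \<rho> (u - (x + y))) -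
        (bump \<rho> (u - y) * bump \<rho> (u - x) - bump \<rho> (u - y) * bump \<rho> (u - (x + y))) \<partial>lborel)"
    by (simp add: bump_difference_def algebra_simps)
  also have "\<dots> = bump_correlation \<rho> (x - 0) - bump_correlation \<rho> (x + y - 0) -
      (bump_correlation \<rho> (x - y) - bump_correlation \<rho> (x + y - y))"
    using int by (simp only: Bochner_Integration.integral_diff Bochner_Integration.integrable_diff
        bump_correlation_translate)
  also have "\<dots> = difference_correlation \<rho> y x"
    by (simp add: difference_correlation_def)
  finally have *: "(\<integral>u. bump_difference \<rho> y u * bump_difference \<rho> y (u - x) \<partial>lborel) = difference_correlation \<rho> y x" .
  show ?thesis
    unfolding self_convolution_def *[symmetric] integral_complex_of_real[symmetric] by simp
qed

text \<open>
  Subtracting a translate multiplies the transform by \<open>1 - cis (2 \<pi> k \<bullet> y)\<close>, which is small for the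
  frequencies \<open>k\<close> at which \<open>y\<close> has a small phase. This is what links the diffraction measure with the
  translation by \<open>y\<close>.
\<close>

lemma inverse_fourier_bump_difference:
  fixes k y :: "real^'n"
  shows "inverse_fourier (\<lambda>u. complex_of_real (bump_difference \<rho> y u)) k =
    (1 - cis (2 * pi * (k \<bullet> y))) * inverse_fourier (\<lambda>u. complex_of_real (bump \<rho> u)) k"
proof -
  let ?f = "\<lambda>u. cis (2 * pi * (k \<bullet> u)) * complex_of_real (bump \<rho> u)"
  have cont: "continuous_on UNIV (\<lambda>u. cis (2 * pi * (k \<bullet> u)))"
    by (intro continuous_intros)
  have int: "integrable lborel ?f"
    by (intro integrable_test_function test_function_bump_times cont)
  have meas: "?f \<in> borel_measurable borel"
    using borel_measurable_integrable[OF int] by simp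
  have int': "integrable lborel (\<lambda>u. ?f (- y + u))"
    using integrable_distr_eq[of "(+) (- y)" lborel borel ?f] int meas by (simp add: lborel_distr_plus)
  have "cis (2 * pi * (k \<bullet> u)) * complex_of_real (bump_difference \<rho> y u) =
      ?f u - cis (2 * pi * (k \<bullet> y)) * ?f (- y + u)" for u
  proof -
    have "cis (2 * pi * (k \<bullet> u)) = cis (2 * pi * (k \<bullet> y)) * cis (2 * pi * (k \<bullet> (- y + u)))"
      by (simp add: cis_mult inner_right_distrib inner_diff_right algebra_simps)
    then show ?thesis by (simp add: bump_difference_def algebra_simps)
  qed
  then have "inverse_fourier (\<lambda>u. complex_of_real (bump_difference \<rho> y u)) k =
      (\<integral>u. ?f u - cis (2 * pi * (k \<bullet> y)) * ?f (- y + u) \<partial>lborel)"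
    by (simp add: inverse_fourier_def)
  also have "\<dots> = (\<integral>u. ?f u \<partial>lborel) - (\<integral>u. cis (2 * pi * (k \<bullet> y)) * ?f (- y + u) \<partial>lborel)"
    using int int' by (intro Bochner_Integration.integral_diff integrable_mult_right) auto
  also have "(\<integral>u. cis (2 * pi * (k \<bullet> y)) * ?f (- y + u) \<partial>lborel) =
      cis (2 * pi * (k \<bullet> y)) * (\<integral>u. ?f u \<partial>lborel)"
    using integral_lborel_translate[OF meas, of "- y"] int' by (simp only: integral_mult_right_zero)
  finally show ?thesis by (simp add: inverse_fourier_def algebra_simps)
qed

text \<open>
  If \<open>2 \<rho>\<close> is at most the minimal distance of \<open>L\<close>, then on \<open>L\<close> the function \<open>difference_correlation\<close> is
  a multiple of \<open>2 \<delta>\<^sub>0 - \<delta>\<^sub>y - \<delta>\<^sub>-\<^sub>y\<close> (with coinciding points added up). The inner sum over \<open>x'\<close> is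
  thus the number of those of the two points \<open>x + y\<close> and \<open>x - y\<close> that are missing from \<open>S\<close>, times
  \<open>bump_correlation \<rho> 0\<close>.
\<close>

lemma difference_correlation_lattice_sum:
  fixes L :: "(real^'n) set"
  assumes "point_lattice L" and sep: "\<And>x. x \<in> L \<Longrightarrow> norm x < 2 * \<rho> \<Longrightarrow> x = 0"
    and S: "S \<subseteq> L" "finite S" and y: "y \<in> L"
  shows "bump_correlation \<rho> (0 :: real^'n) * real (card {x\<in>S. x + y \<notin> S}) \<le> (\<Sum>x\<in>S. \<Sum>x'\<in>S. difference_correlation \<rho> y (x - x'))"
proof -
  interpret point_lattice L by fact
  let ?A = "bump_correlation \<rho> (0 :: real^'n)"
  have A: "?A \<ge> 0"
    unfolding bump_correlation_def by (intro integral_nonneg_AE) (simp add: bump_nonneg)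
  have val: "bump_correlation \<rho> x = (if x = 0 then ?A else 0)" if "x \<in> L" for x
    using sep[OF that] bump_correlation_support[of \<rho> x] by force
  have inner: "?A * of_bool (x + y \<notin> S) \<le> (\<Sum>x'\<in>S. difference_correlation \<rho> y (x - x'))" if x: "x \<in> S" for x
  proof -
    have "difference_correlation \<rho> y (x - x') =
        2 * (if x' = x then ?A else 0) - (if x' = x + y then ?A else 0) - (if x' = x - y then ?A else 0)"
      if x': "x' \<in> S" for x'
    proof -
      have "x - x' \<in> L" "x - x' + y \<in> L" "x - x' - y \<in> L"
        using x x' S(1) y by (auto intro!: diff_mem add_mem)
      then show ?thesis
        by (auto simp: difference_correlation_def val algebra_simps)
    qed
    then have "(\<Sum>x'\<in>S. difference_correlation \<rho> y (x - x')) =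
        2 * ?A - (if x + y \<in> S then ?A else 0) - (if x - y \<in> S then ?A else 0)"
      using S(2) x by (simp add: sum_subtractf sum.delta flip: sum_distrib_left)
    then show ?thesis using A by auto
  qed
  have "?A * real (card {x\<in>S. x + y \<notin> S}) = (\<Sum>x\<in>S. ?A * of_bool (x + y \<notin> S))"
    using S(2) by (simp add: Collect_conj_eq flip: sum_distrib_left)
  also have "\<dots> \<le> (\<Sum>x\<in>S. \<Sum>x'\<in>S. difference_correlation \<rho> y (x - x'))"
    by (intro sum_mono inner)
  finally show ?thesis .
qed

lemma norm_one_minus_cis_le: "norm (1 - cis t) \<le> \<bar>t\<bar>"
proof -
  have "(norm (1 - cis t))\<^sup>2 = (1 - cos t)\<^sup>2 + (sin t)\<^sup>2"
    by (simp add: cmod_power2)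
  also have "\<dots> = 2 - 2 * cos (2 * (t / 2))"
    using sin_cos_squared_add[of t] by (simp add: power2_diff)
  also have "\<dots> = 4 * (sin (t / 2))\<^sup>2"
    unfolding cos_double_sin by simp
  also have "\<dots> \<le> 4 * (t / 2)\<^sup>2"
    using abs_sin_x_le_abs_x[of "t / 2"] by (simp only: abs_le_square_iff)
  also have "\<dots> = \<bar>t\<bar>\<^sup>2" by (simp add: power2_eq_square)
  finally show ?thesis by (rule power2_le_imp_le) simp
qed

text \<open>
  The cell that contains the phases of \<open>y\<close> at the frequencies in \<open>F\<close>, when each circle of phases
  is cut into \<open>n\<close> arcs; the value outside \<open>F\<close> is a default that keeps the range finite.
\<close>

definition phase_class :: "nat \<Rightarrow> (real^'n) set \<Rightarrow> real^'n \<Rightarrow> (real^'n \<Rightarrow> int)" where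
  "phase_class n F y k = (if k \<in> F then \<lfloor>real n * frac (k \<bullet> y)\<rfloor> else 0)"

lemma finite_range_phase_class:
  assumes "finite F"
  shows "finite (range (phase_class n F))"
proof (rule finite_subset)
  show "range (phase_class n F) \<subseteq> {f. \<forall>x. (x \<in> F \<longrightarrow> f x \<in> {0..int n}) \<and> (x \<notin> F \<longrightarrow> f x = 0)}"
  proof (clarsimp simp: phase_class_def)
    fix k y :: "real^'n"
    have "real n * frac (k \<bullet> y) \<le> real n * 1"
      using frac_lt_1[of "k \<bullet> y"] by (intro mult_left_mono) auto
    then show "\<lfloor>real n * frac (k \<bullet> y)\<rfloor> \<le> int n" by linarith
  qed
  show "finite {f. \<forall>x. (x \<in> F \<longrightarrow> f x \<in> {0..int n}) \<and> (x \<notin> F \<longrightarrow> f x = 0)}"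
    using assms by (intro finite_set_of_finite_funs) auto
qed

lemma phase_class_close:
  assumes n: "n > 0" and k: "k \<in> F" and eq: "phase_class n F y = phase_class n F y'"
  shows "norm (1 - cis (2 * pi * (k \<bullet> (y - y')))) \<le> 2 * pi / n"
proof -
  define d where "d = frac (k \<bullet> y) - frac (k \<bullet> y')"
  have "\<lfloor>real n * frac (k \<bullet> y)\<rfloor> = \<lfloor>real n * frac (k \<bullet> y')\<rfloor>"
    using fun_cong[OF eq, of k] k by (simp add: phase_class_def)
  then have "\<bar>real n * frac (k \<bullet> y) - real n * frac (k \<bullet> y')\<bar> \<le> 1" by linarith
  then have "real n * \<bar>d\<bar> \<le> 1"
    by (simp add: d_def abs_mult flip: right_diff_distrib)
  then have d: "\<bar>d\<bar> \<le> 1 / n" using n by (simp add: field_simps)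
  have "k \<bullet> (y - y') = of_int (\<lfloor>k \<bullet> y\<rfloor> - \<lfloor>k \<bullet> y'\<rfloor>) + d"
    by (simp add: d_def frac_def inner_diff_right)
  then have "cis (2 * pi * (k \<bullet> (y - y'))) = cis (2 * pi * of_int (\<lfloor>k \<bullet> y\<rfloor> - \<lfloor>k \<bullet> y'\<rfloor>)) * cis (2 * pi * d)"
    by (simp only: cis_mult distrib_left)
  also have "cis (2 * pi * of_int (\<lfloor>k \<bullet> y\<rfloor> - \<lfloor>k \<bullet> y'\<rfloor>)) = 1"
    by (rule cis_multiple_2pi) simp
  finally have "norm (1 - cis (2 * pi * (k \<bullet> (y - y')))) \<le> \<bar>2 * pi * d\<bar>"
    using norm_one_minus_cis_le[of "2 * pi * d"] by simp
  also have "\<dots> \<le> 2 * pi * (1 / n)"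
    unfolding abs_mult using d by (intro mult_mono) auto
  finally show ?thesis by simp
qed

text \<open>
  The mass of the finite measure with density \<open>w\<close> lies on countably many points, hence up to \<open>\<epsilon>\<close> on
  finitely many of them.
\<close>

lemma pure_point_finite_concentration:
  fixes w :: "real^'n \<Rightarrow> real"
  assumes "pure_point_measure \<mu>" and \<mu>: "sets \<mu> = sets borel" and w: "integrable \<mu> w" "\<And>k. w k \<ge> 0"
    and "\<epsilon> > 0"
  shows "\<exists>F. finite F \<and> (\<integral>k. w k * indicator (- F) k \<partial>\<mu>) < \<epsilon>"
proof -
  obtain C where C: "countable C" "emeasure \<mu> (UNIV - C) = 0"
    using assms(1) by (auto simp: pure_point_measure_def)
  define F where "F n = {k \<in> C. to_nat_on C k < n}" for n
  have finF: "finite (F n)" for n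
  proof (rule finite_imageD)
    show "finite (to_nat_on C ` F n)" by (rule finite_subset[of _ "{..<n}"]) (auto simp: F_def)
    show "inj_on (to_nat_on C) (F n)"
      using inj_on_to_nat_on[OF C(1)] by (rule inj_on_subset) (auto simp: F_def)
  qed
  have "C \<in> sets borel"
    by (rule sets.countable[OF _ C(1)]) simp
  then have "UNIV - C \<in> sets \<mu>"
    unfolding \<mu> Compl_eq_Diff_UNIV[symmetric] by (rule borel_comp)
  then have "UNIV - C \<in> null_sets \<mu>"
    using C(2) by (rule null_setsI[rotated])
  then have "AE k in \<mu>. k \<in> C"
    by (rule AE_I') blast
  have "(\<lambda>n. \<integral>k. w k * indicator (- F n) k \<partial>\<mu>) \<longlonglongrightarrow> (\<integral>k. 0 \<partial>\<mu>)"
  proof (rule integral_dominated_convergence[where w = w])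
    have [measurable]: "F n \<in> sets \<mu>" for n
      unfolding \<mu> using finF by (intro borel_closed finite_imp_closed)
    show "(\<lambda>k. w k * indicator (- F n) k) \<in> borel_measurable \<mu>" for n
      using borel_measurable_integrable[OF w(1)] by measurable
    show "AE k in \<mu>. (\<lambda>n. w k * indicator (- F n) k) \<longlonglongrightarrow> 0"
      using \<open>AE k in \<mu>. k \<in> C\<close>
    proof eventually_elim
      fix k assume "k \<in> C"
      then have "eventually (\<lambda>n. w k * indicator (- F n) k = 0) sequentially"
        by (intro eventually_sequentiallyI[of "Suc (to_nat_on C k)"]) (simp add: F_def)
      then show "(\<lambda>n. w k * indicator (- F n) k) \<longlonglongrightarrow> 0" by (rule tendsto_eventually)
    qed
    show "AE k in \<mu>. norm (w k * indicator (- F n) k) \<le> w k" for n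
      using w(2) by (intro AE_I2) (simp add: indicator_def)
  qed (use w(1) in simp_all)
  then have "eventually (\<lambda>n. (\<integral>k. w k * indicator (- F n) k \<partial>\<mu>) < \<epsilon>) sequentially"
    using \<open>\<epsilon> > 0\<close> by (simp add: order_tendstoD(2))
  then obtain n where "(\<integral>k. w k * indicator (- F n) k \<partial>\<mu>) < \<epsilon>"
    by (auto simp: eventually_sequentially)
  then show ?thesis using finF by blast
qed

text \<open>
  For \<open>v = y - y'\<close> the transform equation, applied to \<open>bump_difference \<rho> v\<close>, equates the integral
  of \<open>difference_correlation \<rho> v\<close> with respect to the autocorrelation, which bounds the density of the points
  leaving \<open>S\<close> under the translation by \<open>v\<close>, with the integral of \<open>\<bar>1 - cis (2 \<pi> k \<bullet> v)\<bar>\<^sup>2 w k\<close>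
  with respect to the diffraction measure. On finitely many frequencies that carry almost all of \<open>w\<close> the
  first factor is small when \<open>y\<close> and \<open>y'\<close> have the same phase class; elsewhere it is at most 4.
\<close>

theorem pure_point_almost_periods:
  fixes L :: "(real^'n) set"
  assumes "point_lattice L" and S: "S \<subseteq> L" and pp: "pure_point_diffractive_set S" and "\<epsilon> > 0"
  shows "\<exists>\<kappa> :: real^'n \<Rightarrow> real^'n \<Rightarrow> int. finite (range \<kappa>) \<and>
    (\<forall>y\<in>L. \<forall>y'\<in>L. \<kappa> y = \<kappa> y' \<longrightarrow> eventually (\<lambda>r.
      real (card {x \<in> S \<inter> cball 0 r. x + (y - y') \<notin> S}) \<le> \<epsilon> * measure lborel (cball (0 :: real^'n) r)) at_top)"
proof -
  interpret point_lattice L by fact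
  obtain \<gamma> \<mu> where \<gamma>: "autocorrelation_of S \<gamma>" and ft: "fourier_transform_of \<gamma> \<mu>"
    and \<mu>: "pure_point_measure \<mu>"
    using pp by (auto simp: pure_point_diffractive_set_def)
  obtain \<rho>' where \<rho>': "\<rho>' > 0" "\<And>x. x \<in> L \<Longrightarrow> norm x < \<rho>' \<Longrightarrow> x = 0" using separated by blast
  define \<rho> where "\<rho> = \<rho>' / 2"
  have \<rho>: "\<rho> > 0" "\<And>x. x \<in> L \<Longrightarrow> norm x < 2 * \<rho> \<Longrightarrow> x = 0" using \<rho>' by (auto simp: \<rho>_def)
  define A where "A = bump_correlation \<rho> (0 :: real^'n)"
  have A: "A > 0" unfolding A_def by (rule bump_correlation_zero_pos[OF \<rho>(1)])
  define w where "w k = (norm (inverse_fourier (\<lambda>u. complex_of_real (bump \<rho> u)) k))\<^sup>2" for k :: "real^'n"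
  have w: "integrable \<mu> w" "\<And>k. w k \<ge> 0"
    unfolding w_def using ft test_function_bump_times[of "\<lambda>_ :: real^'n. 1 :: complex" \<rho>]
    by (auto simp: fourier_transform_of_def)
  have borel: "sets \<mu> = sets borel"
    using ft by (simp add: fourier_transform_of_def locally_finite_borel_def)
  define W where "W = (\<integral>k. w k \<partial>\<mu>)"
  have W: "W \<ge> 0" unfolding W_def using w(2) by (intro integral_nonneg_AE) simp
  have "\<epsilon> * A > 0" using \<open>\<epsilon> > 0\<close> A by simp
  then obtain F where F: "finite F" "(\<integral>k. w k * indicator (- F) k \<partial>\<mu>) < \<epsilon> * A / 8"
    using pure_point_finite_concentration[OF \<mu> borel w, of "\<epsilon> * A / 8"] by auto
  obtain n :: nat where n: "n > 0" "(2 * pi / n)\<^sup>2 * W < \<epsilon> * A / 2"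
  proof -
    have "(\<lambda>n. (2 * pi / real n)\<^sup>2 * W) \<longlonglongrightarrow> 0\<^sup>2 * W"
      by (intro tendsto_intros lim_const_over_n)
    then have "eventually (\<lambda>n. (2 * pi / real n)\<^sup>2 * W < \<epsilon> * A / 2) sequentially"
      by (rule order_tendstoD(2)) (use \<open>\<epsilon> * A > 0\<close> in simp)
    then have "eventually (\<lambda>n. n > 0 \<and> (2 * pi / real n)\<^sup>2 * W < \<epsilon> * A / 2) sequentially"
      using eventually_gt_at_top by (rule eventually_conj[rotated])
    then show ?thesis using that by (auto simp: eventually_sequentially)
  qed
  have "eventually (\<lambda>r. real (card {x \<in> S \<inter> cball 0 r. x + (y - y') \<notin> S})
      \<le> \<epsilon> * measure lborel (cball (0 :: real^'n) r)) at_top"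
    if y: "y \<in> L" "y' \<in> L" and eq: "phase_class n F y = phase_class n F y'" for y y'
  proof -
    define v where "v = y - y'"
    have v: "v \<in> L" using y diff_mem by (simp add: v_def)
    define e where "e k = (norm (1 - cis (2 * pi * (k \<bullet> v))))\<^sup>2" for k :: "real^'n"
    have e4: "e k \<le> 4" for k
    proof -
      have "norm (1 - cis (2 * pi * (k \<bullet> v))) \<le> 2"
        using norm_triangle_ineq4[of 1 "cis (2 * pi * (k \<bullet> v))"] by simp
      then have "e k \<le> 2\<^sup>2" unfolding e_def by (intro power_mono) auto
      then show ?thesis by simp
    qed
    have eF: "e k \<le> (2 * pi / n)\<^sup>2" if "k \<in> F" for k
      unfolding e_def v_def using phase_class_close[OF n(1) that eq] by (intro power_mono) auto
    have sq: "(norm (inverse_fourier (\<lambda>u. complex_of_real (bump_difference \<rho> v u)) k))\<^sup>2 = e k * w k" for k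
      by (simp add: inverse_fourier_bump_difference norm_mult power_mult_distrib e_def w_def)
    have ftv: "integrable \<mu> (\<lambda>k. e k * w k)"
      "complex_of_real (\<integral>x. difference_correlation \<rho> v x \<partial>\<gamma>) = complex_of_real (\<integral>k. e k * w k \<partial>\<mu>)"
      using ft test_function_bump_difference[of \<rho> v]
      by (auto simp: fourier_transform_of_def self_convolution_bump_difference
          simp flip: sq)
    have "- F \<in> sets \<mu>" unfolding borel using F(1) by (intro borel_comp borel_closed finite_imp_closed)
    then have intF: "integrable \<mu> (\<lambda>k. w k * indicator (- F) k)"
      using w(1) by (rule integrable_real_mult_indicator)
    have "(\<integral>x. difference_correlation \<rho> v x \<partial>\<gamma>) = (\<integral>k. e k * w k \<partial>\<mu>)"
      using ftv(2) by (simp only: of_real_eq_iff)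
    also have "\<dots> \<le> (\<integral>k. (2 * pi / n)\<^sup>2 * w k + 4 * (w k * indicator (- F) k) \<partial>\<mu>)"
    proof (rule integral_mono[OF ftv(1)])
      show "integrable \<mu> (\<lambda>k. (2 * pi / n)\<^sup>2 * w k + 4 * (w k * indicator (- F) k))"
        using w(1) intF by (intro Bochner_Integration.integrable_add integrable_mult_right) auto
      show "e k * w k \<le> (2 * pi / n)\<^sup>2 * w k + 4 * (w k * indicator (- F) k)" for k
      proof (cases "k \<in> F")
        case True
        then show ?thesis using mult_right_mono[OF eF[OF True] w(2)] by simp
      next
        case False
        then show ?thesis using mult_right_mono[OF e4 w(2), of k k] w(2)[of k]
          by (simp add: add_increasing)
      qed
    qed
    also have "\<dots> = (2 * pi / n)\<^sup>2 * W + 4 * (\<integral>k. w k * indicator (- F) k \<partial>\<mu>)"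
      using w(1) intF by (simp add: W_def)
    also have "\<dots> < \<epsilon> * A" using n(2) F(2) by simp
    finally have small: "(\<integral>x. difference_correlation \<rho> v x \<partial>\<gamma>) < \<epsilon> * A" .
    have fin: "finite (S \<inter> cball 0 r)" for r using \<gamma> by (simp add: autocorrelation_of_def)
    have "((\<lambda>r. (\<Sum>x \<in> S \<inter> cball 0 r. \<Sum>x' \<in> S \<inter> cball 0 r. difference_correlation \<rho> v (x - x')) /
        measure lborel (cball (0 :: real^'n) r)) \<longlongrightarrow> (\<integral>x. difference_correlation \<rho> v x \<partial>\<gamma>)) at_top"
      using \<gamma> test_function_difference_correlation[of \<rho> v] by (simp add: autocorrelation_of_def)
    then have "eventually (\<lambda>r. (\<Sum>x \<in> S \<inter> cball 0 r. \<Sum>x' \<in> S \<inter> cball 0 r. difference_correlation \<rho> v (x - x')) /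
        measure lborel (cball (0 :: real^'n) r) < \<epsilon> * A) at_top"
      using small by (rule order_tendstoD(2))
    then show ?thesis
      using eventually_gt_at_top[of 0]
    proof eventually_elim
      case (elim r)
      have vol: "measure lborel (cball (0 :: real^'n) r) > 0" using elim(2) by (rule content_cball_pos)
      have "{x \<in> S \<inter> cball 0 r. x + v \<notin> S} \<subseteq> {x \<in> S \<inter> cball 0 r. x + v \<notin> S \<inter> cball 0 r}" by auto
      then have "card {x \<in> S \<inter> cball 0 r. x + v \<notin> S} \<le> card {x \<in> S \<inter> cball 0 r. x + v \<notin> S \<inter> cball 0 r}"
        by (intro card_mono finite_subset[OF _ fin[of r]]) auto
      then have "A * real (card {x \<in> S \<inter> cball 0 r. x + v \<notin> S}) \<le> A * real (card {x \<in> S \<inter> cball 0 r. x + v \<notin> S \<inter> cball 0 r})"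
        using A by simp
      also have "\<dots> \<le> (\<Sum>x \<in> S \<inter> cball 0 r. \<Sum>x' \<in> S \<inter> cball 0 r. difference_correlation \<rho> v (x - x'))"
        unfolding A_def using S fin v
        by (intro difference_correlation_lattice_sum[OF assms(1) \<rho>(2)]) auto
      also have "\<dots> \<le> \<epsilon> * A * measure lborel (cball (0 :: real^'n) r)"
        using elim(1) vol by (simp add: divide_less_eq)
      finally have "A * real (card {x \<in> S \<inter> cball 0 r. x + v \<notin> S}) \<le> A * (\<epsilon> * measure lborel (cball (0 :: real^'n) r))"
        by (simp add: mult_ac)
      then show ?case using A by (simp add: v_def)
    qed
  qed
  then show ?thesis
    using finite_range_phase_class[OF F(1)] by (intro exI[of _ "phase_class n F"]) auto
qed

section \<open>Bijective substitutions on a lattice\<close>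

text \<open>
  The colouring of \<open>L\<close> by components, detached from the matrix function system: the colour of a point
  determines the colours of its images by permutations.
\<close>

locale bijective_substitution = point_lattice L for L :: "(real^'n) set" +
  fixes Q :: "real^'n^'n" and D :: "(real^'n) set" and c :: "real^'n \<Rightarrow> 'm::finite"
  assumes Q_inj: "inj ((*v) Q)"
    and Q_mem: "x \<in> L \<Longrightarrow> Q *v x \<in> L"
    and representatives: "coset_representatives Q L D"
    and zero_digit: "0 \<in> D"
    and finite_digits: "finite D"
    and digit_law: "d \<in> D \<Longrightarrow> \<exists>\<sigma>. bij \<sigma> \<and> (\<forall>x\<in>L. c (Q *v x + d) = \<sigma> (c x))"
begin

abbreviation pow :: "nat \<Rightarrow> real^'n \<Rightarrow> real^'n" where
  "pow n \<equiv> (*v) Q ^^ n"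

lemma digits_subset: "D \<subseteq> L"
  using representatives by (simp add: coset_representatives_def)

lemma digit_unique:
  assumes "x \<in> L" "x' \<in> L" "d \<in> D" "d' \<in> D" and eq: "Q *v x + d = Q *v x' + d'"
  shows "x = x' \<and> d = d'"
proof -
  have mem: "Q *v x + d \<in> L"
    using assms digits_subset by (auto intro: add_mem Q_mem)
  have "\<exists>!d''. d'' \<in> D \<and> (Q *v x + d) - d'' \<in> (*v) Q ` L"
    using representatives mem by (simp only: coset_representatives_def)
  moreover have "(Q *v x + d) - d \<in> (*v) Q ` L"
    unfolding add_diff_cancel_right' using assms(1) by (rule imageI)
  moreover have "(Q *v x + d) - d' \<in> (*v) Q ` L"
    unfolding eq add_diff_cancel_right' using assms(2) by (rule imageI)
  ultimately have "d = d'" using assms by blast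
  moreover from this eq have "x = x'" using Q_inj by (auto dest: injD)
  ultimately show ?thesis by simp
qed

lemma digit_exists: "y \<in> L \<Longrightarrow> \<exists>x\<in>L. \<exists>d\<in>D. y = Q *v x + d"
proof -
  assume "y \<in> L"
  then obtain d x where d: "d \<in> D" "x \<in> L" "y - d = Q *v x"
    using representatives unfolding coset_representatives_def by blast
  then have "y = Q *v x + d" by (metis diff_add_cancel)
  with d show ?thesis by blast
qed

lemma pow_add: "pow n (x + y) = pow n x + pow n y"
  by (induction n) (simp_all add: matrix_vector_right_distrib)

lemma pow_diff: "pow n (x - y) = pow n x - pow n y"
  by (induction n) (simp_all add: matrix_vector_mult_diff_distrib)

lemma pow_zero [simp]: "pow n 0 = 0"
  by (induction n) simp_all

lemma pow_pow: "pow m (pow n x) = pow (m + n) x"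
  by (simp add: funpow_add)

lemma pow_mem: "x \<in> L \<Longrightarrow> pow n x \<in> L"
  by (induction n) (simp_all add: Q_mem)

text \<open>
  The expansions \<open>d\<^sub>0 + Q d\<^sub>1 + \<dots> + Q\<^sup>n\<^sup>-\<^sup>1 d\<^sub>n\<^sub>-\<^sub>1\<close>, so that the sets \<open>pow n x + cell n\<close> with \<open>x\<close> in
  \<open>L\<close> are the level \<open>n\<close> supertiles, each being the \<open>n\<close>-fold inflation of one point.
\<close>

primrec cell :: "nat \<Rightarrow> (real^'n) set" where
  "cell 0 = {0}"
| "cell (Suc n) = {Q *v a + d |a d. a \<in> cell n \<and> d \<in> D}"

lemma cell_subset: "a \<in> cell n \<Longrightarrow> a \<in> L"
  using digits_subset by (induction n arbitrary: a) (auto simp: zero_mem intro!: add_mem Q_mem)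

lemma finite_cell: "finite (cell n)"
proof (induction n)
  case (Suc n)
  have "cell (Suc n) = (\<lambda>(a, d). Q *v a + d) ` (cell n \<times> D)" by auto
  then show ?case using Suc finite_digits by simp
qed simp

lemma zero_cell: "0 \<in> cell n"
  by (induction n) (auto intro!: exI[of _ 0] simp: zero_digit)

lemma cell_add: "a \<in> cell m \<Longrightarrow> b \<in> cell n \<Longrightarrow> pow n a + b \<in> cell (m + n)"
proof (induction n arbitrary: b)
  case (Suc n)
  then obtain b' d where b: "b = Q *v b' + d" "b' \<in> cell n" "d \<in> D" by auto
  have "pow (Suc n) a + b = Q *v (pow n a + b') + d"
    by (simp add: b matrix_vector_right_distrib)
  then show ?case using Suc.IH[OF Suc.prems(1) b(2)] b(3) by auto
qed simp

lemma cell_mono: "m \<le> n \<Longrightarrow> cell m \<subseteq> cell n"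
  using cell_add[OF zero_cell, of _ m "n - m"] by auto

lemma cell_law: "a \<in> cell n \<Longrightarrow> \<exists>\<sigma>. bij \<sigma> \<and> (\<forall>x\<in>L. c (pow n x + a) = \<sigma> (c x))"
proof (induction n arbitrary: a)
  case 0
  then show ?case by (auto intro!: exI[of _ id])
next
  case (Suc n)
  then obtain a' d where a: "a = Q *v a' + d" "a' \<in> cell n" "d \<in> D" by auto
  obtain \<sigma> where \<sigma>: "bij \<sigma>" "\<forall>x\<in>L. c (pow n x + a') = \<sigma> (c x)" using Suc.IH[OF a(2)] by blast
  obtain \<tau> where \<tau>: "bij \<tau>" "\<forall>x\<in>L. c (Q *v x + d) = \<tau> (c x)" using digit_law[OF a(3)] by blast
  have "c (pow (Suc n) x + a) = (\<tau> \<circ> \<sigma>) (c x)" if "x \<in> L" for x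
  proof -
    have "pow (Suc n) x + a = Q *v (pow n x + a') + d"
      by (simp add: a matrix_vector_right_distrib)
    then show ?thesis
      using \<sigma>(2) \<tau>(2) that a(2) by (simp add: add_mem pow_mem cell_subset)
  qed
  then show ?case using bij_comp[OF \<sigma>(1) \<tau>(1)] by blast
qed

lemma cell_exists: "y \<in> L \<Longrightarrow> \<exists>x\<in>L. \<exists>a\<in>cell n. y = pow n x + a"
proof (induction n arbitrary: y)
  case (Suc n)
  obtain x d where x: "x \<in> L" "d \<in> D" "y = Q *v x + d" using digit_exists[OF Suc.prems] by blast
  obtain x' a where "x' \<in> L" "a \<in> cell n" "x = pow n x' + a" using Suc.IH[OF x(1)] by blast
  with x show ?case
    by (intro bexI[of _ x'] bexI[of _ "Q *v a + d"]) (auto simp: matrix_vector_right_distrib)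
qed simp

lemma pow_cell_mem: "x \<in> L \<Longrightarrow> a \<in> cell m \<Longrightarrow> pow n x + a \<in> L"
  by (intro add_mem pow_mem) (auto dest: cell_subset)

lemma cell_unique:
  "x \<in> L \<Longrightarrow> x' \<in> L \<Longrightarrow> a \<in> cell n \<Longrightarrow> a' \<in> cell n \<Longrightarrow> pow n x + a = pow n x' + a' \<Longrightarrow>
    x = x' \<and> a = a'"
proof (induction n arbitrary: a a')
  case (Suc n)
  obtain b d where b: "a = Q *v b + d" "b \<in> cell n" "d \<in> D" using Suc.prems by auto
  obtain b' d' where b': "a' = Q *v b' + d'" "b' \<in> cell n" "d' \<in> D" using Suc.prems by auto
  have "Q *v (pow n x + b) + d = Q *v (pow n x' + b') + d'"
    using Suc.prems(5) by (simp add: b b' matrix_vector_right_distrib add.assoc)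
  then have "pow n x + b = pow n x' + b' \<and> d = d'"
    using Suc.prems(1,2) b(2,3) b'(2,3) by (intro digit_unique pow_cell_mem)
  then show ?case using Suc.IH[of b b'] Suc.prems b b' by auto
qed simp

text \<open>
  The point in question is shifted into
  \<open>pow (M + n) (x + z) + pow M a + b\<close>. The common digits \<open>b\<close> act by one and the same permutation,
  which may be cancelled; what remains is a comparison of the permutations of \<open>a\<close> and \<open>a + z\<close>.
\<close>

lemma permuted_shift_violates_return:
  assumes a: "a \<in> cell n" "a + z \<in> cell n" and z: "z \<in> L"
  shows "\<exists>\<sigma>. bij \<sigma> \<and> (\<forall>x\<in>L. c (x + z) \<noteq> \<sigma> (c x) \<longrightarrow> (\<forall>M. \<forall>b\<in>cell M.
    c (pow (M + n) x + pow M (a + z) + b) \<noteq>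
    c (pow (M + n) x + pow M (a + z) + b + (pow (M + n) z - pow M z))))"
proof -
  obtain \<sigma> where \<sigma>: "bij \<sigma>" "\<And>x. x \<in> L \<Longrightarrow> c (pow n x + a) = \<sigma> (c x)"
    using cell_law[OF a(1)] by blast
  obtain \<tau> where \<tau>: "bij \<tau>" "\<And>x. x \<in> L \<Longrightarrow> c (pow n x + (a + z)) = \<tau> (c x)"
    using cell_law[OF a(2)] by blast
  have "c (pow (M + n) x + pow M (a + z) + b) \<noteq>
      c (pow (M + n) x + pow M (a + z) + b + (pow (M + n) z - pow M z))"
    if x: "x \<in> L" "c (x + z) \<noteq> (inv_into UNIV \<sigma> \<circ> \<tau>) (c x)" and b: "b \<in> cell M" for x M b
  proof -
    obtain \<beta> where \<beta>: "bij \<beta>" "\<And>x. x \<in> L \<Longrightarrow> c (pow M x + b) = \<beta> (c x)"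
      using cell_law[OF b] by blast
    have eq1: "pow (M + n) x + pow M (a + z) + b = pow M (pow n x + (a + z)) + b"
      by (simp add: pow_add flip: pow_pow)
    then have 1: "c (pow (M + n) x + pow M (a + z) + b) = \<beta> (\<tau> (c x))"
      unfolding eq1 using \<beta>(2)[OF pow_cell_mem[OF x(1) a(2)]] \<tau>(2)[OF x(1)] by simp
    have eq2: "pow (M + n) x + pow M (a + z) + b + (pow (M + n) z - pow M z) = pow M (pow n (x + z) + a) + b"
      by (simp add: pow_add flip: pow_pow)
    then have 2: "c (pow (M + n) x + pow M (a + z) + b + (pow (M + n) z - pow M z)) = \<beta> (\<sigma> (c (x + z)))"
      unfolding eq2
      using \<beta>(2)[OF pow_cell_mem[OF add_mem[OF x(1) z] a(1)]] \<sigma>(2)[OF add_mem[OF x(1) z]] by simp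
    have "\<sigma> (c (x + z)) \<noteq> \<tau> (c x)"
      using x(2) \<sigma>(1) by (auto simp: bij_is_inj inv_f_eq)
    then show ?thesis
      unfolding 1 2 using \<beta>(1) by (metis bij_pointE)
  qed
  moreover have "bij (inv_into UNIV \<sigma> \<circ> \<tau>)"
    using \<sigma>(1) \<tau>(1) by (simp add: bij_comp bij_imp_bij_inv)
  ultimately show ?thesis by blast
qed

end

text \<open>
  The assumption \<open>legal\<close> describes a finite cluster \<open>F\<close> that occurs, up to a translation \<open>t\<close>, in the
  \<open>k\<close>-fold inflation of a point of colour \<open>i\<close>.
\<close>

locale primitive_bijective_substitution = bijective_substitution L Q D c
  for L :: "(real^'n) set" and Q D and c :: "real^'n \<Rightarrow> 'm::finite" +
  assumes primitive: "\<exists>k. \<forall>i. \<forall>x\<in>L. \<exists>a\<in>cell k. c (pow k x + a) = i"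
    and legal: "F \<subseteq> L \<Longrightarrow> finite F \<Longrightarrow>
      \<exists>k t i. \<forall>u\<in>F. t + u \<in> cell k \<and> (\<forall>x\<in>L. c x = i \<longrightarrow> c (pow k x + (t + u)) = c u)"
    and aperiodic: "z \<in> L \<Longrightarrow> (\<And>x. x \<in> L \<Longrightarrow> c (x + z) = c x) \<Longrightarrow> z = 0"
begin

text \<open>
  Otherwise \<open>c (x + n z) = (\<sigma> ^^ n) (c x)\<close> for all \<open>n\<close>. Two powers of \<open>\<sigma>\<close> coincide as there are finitely
  many maps of colours, and the difference of the exponents yields a period that is a nonzero multiple
  of \<open>z\<close>.
\<close>

lemma shift_not_permutation:
  assumes z: "z \<in> L" "z \<noteq> 0"
  shows "\<exists>x\<in>L. c (x + z) \<noteq> \<sigma> (c x)"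
proof (rule ccontr)
  assume "\<not> ?thesis"
  then have step: "c (x + z) = \<sigma> (c x)" if "x \<in> L" for x using that by blast
  have mult_mem: "real n *\<^sub>R z \<in> L" for n
    by (induction n) (simp_all add: zero_mem add_mem z algebra_simps)
  have iter: "c (x + real n *\<^sub>R z) = (\<sigma> ^^ n) (c x)" if "x \<in> L" for x n
  proof (induction n)
    case (Suc n)
    have "c (x + real (Suc n) *\<^sub>R z) = c (x + real n *\<^sub>R z + z)" by (simp add: algebra_simps)
    also have "\<dots> = \<sigma> (c (x + real n *\<^sub>R z))"
      using that mult_mem by (intro step add_mem)
    finally show ?case using Suc by simp
  qed simp
  have "\<not> inj (\<lambda>n. \<sigma> ^^ n)"
    using finite_imageD[of "\<lambda>n. \<sigma> ^^ n" UNIV] finite_subset[OF subset_UNIV] by auto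
  then obtain i j where "i \<noteq> j" "\<sigma> ^^ i = \<sigma> ^^ j" by (auto simp: inj_def)
  then obtain i j where ij: "i < j" "\<sigma> ^^ i = \<sigma> ^^ j" by (metis nat_neq_iff)
  have "real (j - i) *\<^sub>R z = 0"
  proof (rule aperiodic[OF mult_mem])
    fix x assume x: "x \<in> L"
    define x' where "x' = x - real i *\<^sub>R z"
    have x': "x' \<in> L" using x mult_mem by (simp add: x'_def diff_mem)
    have "c (x' + real j *\<^sub>R z) = c (x' + real i *\<^sub>R z)" using iter[OF x'] ij by simp
    then show "c (x + real (j - i) *\<^sub>R z) = c x"
      using ij(1) by (simp add: x'_def of_nat_diff algebra_simps)
  qed
  with ij z show False by simp
qed

text \<open>
  The two-point cluster \<open>{u, u + z}\<close> on which \<open>\<sigma>\<close> fails lies in the inflation of a point of some colour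
  by legality, and every supertile of a suitable level contains such a point by primitivity.
\<close>

lemma syndetic_permutation_failure:
  assumes z: "z \<in> L" "z \<noteq> 0"
  shows "\<exists>K. \<forall>x\<in>L. \<exists>e\<in>cell K. c (pow K x + e + z) \<noteq> \<sigma> (c (pow K x + e))"
proof -
  obtain u where u: "u \<in> L" "c (u + z) \<noteq> \<sigma> (c u)" using shift_not_permutation[OF z] by blast
  obtain k t i where k: "\<And>v. v \<in> {u, u + z} \<Longrightarrow> t + v \<in> cell k"
      "\<And>v x. v \<in> {u, u + z} \<Longrightarrow> x \<in> L \<Longrightarrow> c x = i \<Longrightarrow> c (pow k x + (t + v)) = c v"
    using legal[of "{u, u + z}"] u(1) z(1) add_mem by (metis empty_subsetI finite.simps insert_subset)
  obtain p where p: "\<And>x. x \<in> L \<Longrightarrow> \<exists>a\<in>cell p. c (pow p x + a) = i"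
    using primitive by blast
  have "\<exists>e\<in>cell (p + k). c (pow (p + k) x + e + z) \<noteq> \<sigma> (c (pow (p + k) x + e))" if x: "x \<in> L" for x
  proof -
    obtain a where a: "a \<in> cell p" "c (pow p x + a) = i" using p[OF x] by blast
    define y where "y = pow p x + a"
    have y: "y \<in> L" "c y = i" using x a cell_subset by (auto simp: y_def add_mem pow_mem)
    define e where "e = pow k a + (t + u)"
    have "e \<in> cell (p + k)" unfolding e_def using a k(1) by (intro cell_add) auto
    moreover have "pow (p + k) x + e = pow k y + (t + u)" "pow (p + k) x + e + z = pow k y + (t + (u + z))"
      by (simp_all add: e_def y_def pow_add pow_pow add.commute[of p k] add.assoc)
    moreover have "c (pow k y + (t + u)) = c u" "c (pow k y + (t + (u + z))) = c (u + z)"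
      using k(2) y by blast+
    ultimately show ?thesis using u(2) by (metis (no_types))
  qed
  then show ?thesis by blast
qed

lemma uniformly_syndetic_permutation_failure:
  assumes z: "z \<in> L" "z \<noteq> 0"
  shows "\<exists>K. \<forall>\<sigma>. \<forall>x\<in>L. \<exists>e\<in>cell K. c (pow K x + e + z) \<noteq> \<sigma> (c (pow K x + e))"
proof -
  have "\<exists>K. \<forall>\<sigma>. \<forall>x\<in>L. \<exists>e\<in>cell (K \<sigma>). c (pow (K \<sigma>) x + e + z) \<noteq> \<sigma> (c (pow (K \<sigma>) x + e))"
    using syndetic_permutation_failure[OF z] by (intro choice allI)
  then obtain K where K: "\<And>\<sigma> x. x \<in> L \<Longrightarrow>
      \<exists>e\<in>cell (K \<sigma>). c (pow (K \<sigma>) x + e + z) \<noteq> \<sigma> (c (pow (K \<sigma>) x + e))" by blast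
  \<comment> \<open>A cell of level \<open>K'\<close> contains one of each lower level, by padding with the digit 0.\<close>
  define K' where "K' = Max (range K)"
  have "\<exists>e\<in>cell K'. c (pow K' x + e + z) \<noteq> \<sigma> (c (pow K' x + e))" if x: "x \<in> L" for \<sigma> x
  proof -
    have le: "K \<sigma> \<le> K'" by (simp add: K'_def)
    obtain e where e: "e \<in> cell (K \<sigma>)"
        "c (pow (K \<sigma>) (pow (K' - K \<sigma>) x) + e + z) \<noteq> \<sigma> (c (pow (K \<sigma>) (pow (K' - K \<sigma>) x) + e))"
      using K[OF pow_mem[OF x]] by blast
    then show ?thesis using cell_mono[OF le] le by (auto simp: pow_pow intro!: bexI[of _ e])
  qed
  then show ?thesis by blast
qed

text \<open>
  With \<open>y = pow (M + n) z - pow M z\<close>, the map \<open>T\<close> moves every lattice point by a bounded distance to a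
  point whose colour changes under the translation by \<open>y\<close>, and is at most \<open>N\<close> to one. The point is that
  \<open>N\<close> does not depend on \<open>M\<close> and \<open>n\<close>, while the bound \<open>C\<close> may: this gives a uniform lower bound for the
  density of colour changes. To construct \<open>T\<close>, a lattice point is expanded in blocks of \<open>M\<close>, \<open>k\<close>, \<open>n - k\<close>
  and \<open>K\<close> digits. The block of \<open>k\<close> digits is replaced by \<open>t + z\<close> and the one of \<open>K\<close> digits by one for
  which the permutation that belongs to the digits between them fails. Only these two blocks
  are forgotten, so there are at most \<open>card (cell K \<times> cell k)\<close> preimages.
\<close>

theorem colour_changes_dense:
  assumes z: "z \<in> L" "z \<noteq> 0"
  shows "\<exists>k N. N > 0 \<and> (\<forall>M n. n \<ge> k \<longrightarrow> (\<exists>T C. (\<forall>x\<in>L. T x \<in> L \<and> norm (T x - x) \<le> C \<and>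
      c (T x) \<noteq> c (T x + (pow (M + n) z - pow M z))) \<and>
      (\<forall>X. X \<subseteq> L \<longrightarrow> finite X \<longrightarrow> card X \<le> N * card (T ` X))))"
proof -
  obtain K where K: "\<And>\<sigma> x. x \<in> L \<Longrightarrow> \<exists>e\<in>cell K. c (pow K x + e + z) \<noteq> \<sigma> (c (pow K x + e))"
    using uniformly_syndetic_permutation_failure[OF z] by blast
  obtain k t where t: "t + 0 \<in> cell k" "t + z \<in> cell k"
    using legal[of "{0, z}"] z(1) zero_mem by (metis empty_subsetI finite.simps insertCI insert_subset)
  define N where "N = card (cell K \<times> cell k)"
  have "N > 0" using finite_cell zero_cell by (auto simp: N_def card_gt_0_iff)
  moreover have "\<exists>T C. (\<forall>x\<in>L. T x \<in> L \<and> norm (T x - x) \<le> C \<and>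
      c (T x) \<noteq> c (T x + (pow (M + n) z - pow M z))) \<and>
      (\<forall>X. X \<subseteq> L \<longrightarrow> finite X \<longrightarrow> card X \<le> N * card (T ` X))" if "n \<ge> k" for M n
  proof -
    define j where "j = n - k"
    have n: "n = j + k" using that by (simp add: j_def)
    have change: "\<exists>e\<in>cell K. \<forall>b\<in>cell M.
        c (pow (M + n) (pow K x + e) + pow M (pow k a + (t + z)) + b) \<noteq>
        c (pow (M + n) (pow K x + e) + pow M (pow k a + (t + z)) + b + (pow (M + n) z - pow M z))"
      if x: "x \<in> L" and a: "a \<in> cell j" for x a
    proof -
      have "pow k a + t \<in> cell n" "pow k a + t + z \<in> cell n"
        using cell_add[OF a t(1)] cell_add[OF a t(2)] by (simp_all add: n add.assoc)
      from permuted_shift_violates_return[OF this z(1)] obtain \<sigma> where \<sigma>: "\<And>x b. x \<in> L \<Longrightarrow>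
          c (x + z) \<noteq> \<sigma> (c x) \<Longrightarrow> b \<in> cell M \<Longrightarrow>
          c (pow (M + n) x + pow M (pow k a + t + z) + b) \<noteq>
          c (pow (M + n) x + pow M (pow k a + t + z) + b + (pow (M + n) z - pow M z))" by blast
      obtain e where e: "e \<in> cell K" "c (pow K x + e + z) \<noteq> \<sigma> (c (pow K x + e))"
        using K[OF x] by blast
      have "pow K x + e \<in> L" using x e cell_subset by (simp add: add_mem pow_mem)
      from \<sigma>[OF this e(2)] e(1) show ?thesis by (auto simp: add.assoc)
    qed
    then obtain \<epsilon> where \<epsilon>: "\<And>x a. x \<in> L \<Longrightarrow> a \<in> cell j \<Longrightarrow> \<epsilon> x a \<in> cell K"
      "\<And>x a b. x \<in> L \<Longrightarrow> a \<in> cell j \<Longrightarrow> b \<in> cell M \<Longrightarrow>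
        c (pow (M + n) (pow K x + \<epsilon> x a) + pow M (pow k a + (t + z)) + b) \<noteq>
        c (pow (M + n) (pow K x + \<epsilon> x a) + pow M (pow k a + (t + z)) + b + (pow (M + n) z - pow M z))"
      by metis
    define \<Psi> where "\<Psi> x e a b' b = pow M (pow k (pow j (pow K x + e) + a) + b') + b" for x e a b' b
    have \<Psi>_mem: "\<Psi> x e a b' b \<in> L"
      if "x \<in> L" "e \<in> cell K" "a \<in> cell j" "b' \<in> cell k" "b \<in> cell M" for x e a b' b
      unfolding \<Psi>_def using that by (intro pow_cell_mem)
    have \<Psi>_inj: "x = x' \<and> e = e' \<and> a = a' \<and> d = d' \<and> b = b'"
      if "x \<in> L" "e \<in> cell K" "a \<in> cell j" "d \<in> cell k" "b \<in> cell M"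
        "x' \<in> L" "e' \<in> cell K" "a' \<in> cell j" "d' \<in> cell k" "b' \<in> cell M"
        "\<Psi> x e a d b = \<Psi> x' e' a' d' b'" for x e a d b x' e' a' d' b'
    proof -
      have 1: "pow k (pow j (pow K x + e) + a) + d = pow k (pow j (pow K x' + e') + a') + d' \<and> b = b'"
        using that unfolding \<Psi>_def by (intro cell_unique pow_cell_mem)
      have 2: "pow j (pow K x + e) + a = pow j (pow K x' + e') + a' \<and> d = d'"
        by (rule cell_unique[OF _ _ _ _ conjunct1[OF 1]]; (rule pow_cell_mem that)+)
      have 3: "pow K x + e = pow K x' + e' \<and> a = a'"
        by (rule cell_unique[OF _ _ _ _ conjunct1[OF 2]]; (rule pow_cell_mem that)+)
      have "x = x' \<and> e = e'"
        by (rule cell_unique[OF _ _ _ _ conjunct1[OF 3]]; (rule that)+)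
      with 1 2 3 show ?thesis by blast
    qed
    have "\<exists>x e a d b. x \<in> L \<and> e \<in> cell K \<and> a \<in> cell j \<and> d \<in> cell k \<and> b \<in> cell M \<and> y = \<Psi> x e a d b"
      if "y \<in> L" for y
      unfolding \<Psi>_def by (metis cell_exists that)
    then obtain X E A B' B where rep: "\<And>y. y \<in> L \<Longrightarrow> X y \<in> L \<and> E y \<in> cell K \<and> A y \<in> cell j \<and>
        B' y \<in> cell k \<and> B y \<in> cell M \<and> y = \<Psi> (X y) (E y) (A y) (B' y) (B y)" by metis
    define T where "T y = \<Psi> (X y) (\<epsilon> (X y) (A y)) (A y) (t + z) (B y)" for y
    \<comment> \<open>a finite set that contains all values of \<open>T y - y\<close>\<close>
    define W where "W = (\<lambda>(e', e, b'). pow M (pow k (pow j (e' - e)) + (t + z - b'))) ` (cell K \<times> cell K \<times> cell k)"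
    have "bounded W" unfolding W_def using finite_cell by (intro finite_imp_bounded) auto
    then obtain C where C: "\<And>w. w \<in> W \<Longrightarrow> norm w \<le> C" by (auto simp: bounded_iff)
    have "T y \<in> L \<and> norm (T y - y) \<le> C \<and> c (T y) \<noteq> c (T y + (pow (M + n) z - pow M z))"
      if y: "y \<in> L" for y
    proof (intro conjI)
      note r = rep[OF y]
      show "T y \<in> L" unfolding T_def using r \<epsilon>(1) t(2) by (intro \<Psi>_mem) auto
      have "T y - y = T y - \<Psi> (X y) (E y) (A y) (B' y) (B y)" using r by simp
      also have "\<dots> = pow M (pow k (pow j (\<epsilon> (X y) (A y) - E y)) + (t + z - B' y))"
        by (simp add: T_def \<Psi>_def pow_add pow_diff)
      also have "\<dots> \<in> W"
        unfolding W_def using r \<epsilon>(1) by (intro image_eqI[of _ _ "(\<epsilon> (X y) (A y), E y, B' y)"]) auto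
      finally show "norm (T y - y) \<le> C" by (rule C)
      have "T y = pow (M + n) (pow K (X y) + \<epsilon> (X y) (A y)) + pow M (pow k (A y) + (t + z)) + B y"
        by (simp add: T_def \<Psi>_def n pow_add pow_pow add_ac)
      then show "c (T y) \<noteq> c (T y + (pow (M + n) z - pow M z))"
        using \<epsilon>(2) r by metis
    qed
    moreover have "card Y \<le> N * card (T ` Y)" if Y: "Y \<subseteq> L" "finite Y" for Y
    proof -
      define G where "G y = (T y, E y, B' y)" for y
      have "inj_on G Y"
      proof (rule inj_onI)
        fix y y' assume yy: "y \<in> Y" "y' \<in> Y" "G y = G y'"
        note r = rep[OF subsetD[OF Y(1) yy(1)]] and r' = rep[OF subsetD[OF Y(1) yy(2)]]
        have "X y = X y' \<and> \<epsilon> (X y) (A y) = \<epsilon> (X y') (A y') \<and> A y = A y' \<and> t + z = t + z \<and> B y = B y'"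
          using r r' \<epsilon>(1) t(2) yy(3) by (intro \<Psi>_inj) (auto simp: G_def T_def)
        with yy(3) r r' show "y = y'" by (metis G_def prod.inject)
      qed
      then have "card Y = card (G ` Y)" by (simp add: card_image)
      also have "\<dots> \<le> card (T ` Y \<times> (cell K \<times> cell k))"
        using Y rep finite_cell by (intro card_mono) (auto simp: G_def)
      finally show ?thesis by (simp add: N_def card_cartesian_product mult_ac)
    qed
    ultimately show ?thesis by (intro exI[of _ T] exI[of _ C]) auto
  qed
  ultimately show ?thesis by blast
qed

end

section \<open>Colour classes are neither model sets nor pure point diffractive\<close>

text \<open>
  Balls of a fixed radius around the lattice points in \<open>cball 0 (r - C)\<close> cover \<open>cball 0 (r / 2)\<close> for
  large \<open>r\<close>; the constant \<open>\<delta>\<close> depends on this radius and on the dimension, but not on \<open>C\<close>.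
\<close>

lemma (in point_lattice) counting_lower_bound:
  "\<exists>\<delta>>0. \<forall>C. eventually (\<lambda>r. \<delta> * measure lborel (cball (0 :: real^'n) r) \<le>
    real (card (L \<inter> cball 0 (r - C)))) at_top"
proof -
  obtain R where R: "R > 0" "\<And>x. \<exists>y\<in>L. norm (x - y) < R" using relatively_dense by blast
  define d where "d = CARD('n)"
  define v where "v = unit_ball_vol (real d)"
  have vol: "measure lborel (cball x r) = v * r ^ d" if "r \<ge> 0" for x :: "real^'n" and r
    using that by (simp add: content_cball v_def d_def)
  have v: "v > 0" using vol[of 1 "0 :: real^'n"] content_cball_pos[of 1 "0 :: real^'n"] by simp
  define \<delta> where "\<delta> = 1 / (2 ^ d * (v * R ^ d))"
  have "\<delta> > 0" using R(1) v by (simp add: \<delta>_def)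
  moreover have "eventually (\<lambda>r. \<delta> * measure lborel (cball (0 :: real^'n) r) \<le>
      real (card (L \<inter> cball 0 (r - C)))) at_top" for C
    using eventually_ge_at_top[of "2 * (\<bar>C\<bar> + R)"]
  proof eventually_elim
    case (elim r)
    define X where "X = L \<inter> cball 0 (r - C)"
    have fin: "finite X" unfolding X_def by (intro finite_bounded bounded_cball)
    have r: "r \<ge> 0" using elim R(1) by simp
    have cover: "cball 0 (r / 2) \<subseteq> (\<Union>y\<in>X. cball y R)"
    proof
      fix x :: "real^'n" assume x: "x \<in> cball 0 (r / 2)"
      obtain y where y: "y \<in> L" "norm (x - y) < R" using R(2) by blast
      have "norm y \<le> norm x + norm (x - y)" by (metis norm_minus_commute norm_triangle_sub)
      then have "norm y \<le> r - C" using x y(2) elim by simp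
      with y show "x \<in> (\<Union>y\<in>X. cball y R)"
        by (auto simp: X_def dist_norm norm_minus_commute intro!: bexI[of _ y])
    qed
    have "v * (r / 2) ^ d = measure lborel (cball (0 :: real^'n) (r / 2))" using r by (simp add: vol)
    also have "\<dots> \<le> measure lborel (\<Union>y\<in>X. cball y R)"
      by (intro measure_mono_fmeasurable cover fmeasurable.finite_UN fin)
        (auto intro!: fmeasurableI emeasure_lborel_cball_finite)
    also have "\<dots> \<le> (\<Sum>y\<in>X. measure lborel (cball y R))"
      using fin by (intro measure_UNION_le) auto
    also have "\<dots> = card X * (v * R ^ d)" using R(1) by (simp add: vol)
    finally have "v * (r / 2) ^ d \<le> card X * (v * R ^ d)" .
    then have "v * r ^ d \<le> card X * (v * R ^ d) * 2 ^ d"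
      by (simp add: power_divide divide_le_eq)
    then show ?case
      using R(1) v r by (simp add: vol \<delta>_def X_def divide_le_eq mult_ac)
  qed
  ultimately show ?thesis by blast
qed

lemma sequence_repeats_finite_colouring:
  assumes "finite (\<kappa> ` A)" and "\<And>n :: nat. f n \<in> A"
  shows "\<exists>M\<ge>M0. \<exists>n\<ge>k. \<kappa> (f (M + n)) = \<kappa> (f M)"
proof -
  have "finite ((\<lambda>n. \<kappa> (f n)) ` UNIV)"
    using assms by (auto intro: finite_subset[OF _ assms(1)])
  then obtain m where m: "infinite {n. \<kappa> (f n) = \<kappa> (f m)}"
    using pigeonhole_infinite[of "UNIV :: nat set" "\<lambda>n. \<kappa> (f n)"] by auto
  then obtain M where M: "M \<ge> M0" "\<kappa> (f M) = \<kappa> (f m)"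
    unfolding infinite_nat_iff_unbounded_le by blast
  obtain N where N: "N \<ge> M + k" "\<kappa> (f N) = \<kappa> (f m)"
    using m unfolding infinite_nat_iff_unbounded_le by blast
  have "N = M + (N - M)" "N - M \<ge> k" using N(1) by simp_all
  with M N(2) show ?thesis by metis
qed

context primitive_bijective_substitution
begin

text \<open>
  A colour class that is a model set contains a relatively dense set \<open>S'\<close> that the translation by
  \<open>y = pow (M + n) z - pow M z\<close> keeps in the class. The points with colour changes under \<open>y\<close> contain a
  translate of \<open>cell M\<close>, hence of a ball of \<open>L\<close> so large that it meets \<open>S'\<close>.
\<close>

lemma not_model_set: "\<not> model_set TYPE('h) {x \<in> L. c x = i}"
proof
  let ?S = "{x \<in> L. c x = i}"
  assume "model_set TYPE('h) ?S"
  from model_set_returns[OF point_lattice_axioms this]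
  obtain S' R and \<kappa> :: "real^'n \<Rightarrow> (real^'n) \<times> 'h" where S': "S' \<subseteq> ?S"
    and dense: "\<And>x. \<exists>w\<in>S'. norm (x - w) < R" and fin: "finite (\<kappa> ` L)"
    and ret: "\<And>y y' w. y \<in> L \<Longrightarrow> y' \<in> L \<Longrightarrow> \<kappa> y = \<kappa> y' \<Longrightarrow> w \<in> S' \<Longrightarrow> w + (y - y') \<in> ?S"
    by blast
  obtain z where z: "z \<in> L" "z \<noteq> 0" using nonzero_mem by blast
  obtain k t where t: "t + 0 \<in> cell k" "t + z \<in> cell k"
    using legal[of "{0, z}"] z(1) zero_mem by (metis empty_subsetI finite.simps insertCI insert_subset)
  obtain M0 s where s: "\<And>u. u \<in> L \<inter> cball 0 R \<Longrightarrow> s + u \<in> cell M0"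
    using legal[of "L \<inter> cball 0 R"] finite_bounded[OF bounded_cball] by (metis Int_lower1)
  have "R > 0" using dense[of 0] norm_ge_zero le_less_trans by blast
  then have "s \<in> L" using s[of 0] zero_mem cell_subset by simp
  obtain M n where Mn: "M \<ge> M0" "n \<ge> k" "\<kappa> (pow (M + n) z) = \<kappa> (pow M z)"
    using sequence_repeats_finite_colouring[OF fin, of "\<lambda>n. pow n z"] pow_mem[OF z(1)] by blast
  have "t \<in> cell n" "t + z \<in> cell n" using t cell_mono[OF Mn(2)] by auto
  from permuted_shift_violates_return[OF this z(1)] obtain \<sigma> where \<sigma>: "\<And>x b. x \<in> L \<Longrightarrow>
      c (x + z) \<noteq> \<sigma> (c x) \<Longrightarrow> b \<in> cell M \<Longrightarrow>
      c (pow (M + n) x + pow M (t + z) + b) \<noteq>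
      c (pow (M + n) x + pow M (t + z) + b + (pow (M + n) z - pow M z))" by blast
  obtain x where x: "x \<in> L" "c (x + z) \<noteq> \<sigma> (c x)" using shift_not_permutation[OF z] by blast
  \<comment> \<open>\<open>w0 + (s + u)\<close> has a colour change for every \<open>u\<close> of norm at most \<open>R\<close>; \<open>w\<close> is such a point in \<open>S'\<close>.\<close>
  define w0 where "w0 = pow (M + n) x + pow M (t + z)"
  have w0: "w0 \<in> L" unfolding w0_def by (rule add_mem[OF pow_mem[OF x(1)] pow_mem[OF cell_subset[OF t(2)]]])
  obtain w where w: "w \<in> S'" "norm (w0 + s - w) < R" using dense by blast
  have wS: "w \<in> L" "c w = i" using w(1) S' by auto
  define u where "u = w - (w0 + s)"
  have "u \<in> L" unfolding u_def by (intro diff_mem add_mem wS w0 \<open>s \<in> L\<close>)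
  moreover have "norm u \<le> R" using w(2) by (simp add: u_def norm_minus_commute)
  ultimately have "s + u \<in> cell M" using s cell_mono[OF Mn(1)] by auto
  from \<sigma>[OF x this] have "c w \<noteq> c (w + (pow (M + n) z - pow M z))"
    by (simp add: u_def w0_def)
  moreover have "w + (pow (M + n) z - pow M z) \<in> ?S"
    by (intro ret pow_mem z(1) Mn(3) w(1))
  ultimately show False using wS(2) by simp
qed

text \<open>
  The lower bound for the density of colour changes does not depend on the choice of \<open>M\<close> and \<open>n\<close>,
  so \<open>\<epsilon>\<close> can be chosen before them. One pigeonhole argument has to serve all colours at once, since a
  colour change of a point is seen only by the class of its own colour.
\<close>

lemma not_pure_point_diffractive: "\<exists>i. \<not> pure_point_diffractive_set {x \<in> L. c x = i}"
proof (rule ccontr)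
  assume "\<not> ?thesis"
  then have pp: "pure_point_diffractive_set {x \<in> L. c x = i}" for i by blast
  obtain z where z: "z \<in> L" "z \<noteq> 0" using nonzero_mem by blast
  obtain k N where N: "N > 0" and dense: "\<And>M n. n \<ge> k \<Longrightarrow> (\<exists>T C. (\<forall>x\<in>L. T x \<in> L \<and> norm (T x - x) \<le> C \<and>
      c (T x) \<noteq> c (T x + (pow (M + n) z - pow M z))) \<and>
      (\<forall>X. X \<subseteq> L \<longrightarrow> finite X \<longrightarrow> card X \<le> N * card (T ` X)))"
    using colour_changes_dense[OF z] by blast
  obtain \<delta> where \<delta>: "\<delta> > 0" and count: "\<And>C. eventually (\<lambda>r.
      \<delta> * measure lborel (cball (0 :: real^'n) r) \<le> real (card (L \<inter> cball 0 (r - C)))) at_top"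
    using counting_lower_bound by blast
  \<comment> \<open>Summing \<open>\<epsilon>\<close> over all colours and multiplying by \<open>N\<close> gives half of the lower bound \<open>\<delta>\<close>.\<close>
  define \<epsilon> where "\<epsilon> = \<delta> / (2 * N * CARD('m))"
  have "\<epsilon> > 0" using \<delta> N by (simp add: \<epsilon>_def)
  define E where "E i v r = {x \<in> {x \<in> L. c x = i} \<inter> cball 0 r. x + v \<notin> {x \<in> L. c x = i}}" for i v r
  define sparse where "sparse i v \<longleftrightarrow> eventually (\<lambda>r.
    real (card (E i v r)) \<le> \<epsilon> * measure lborel (cball (0 :: real^'n) r)) at_top" for i v
  have "\<forall>i. \<exists>\<kappa> :: real^'n \<Rightarrow> real^'n \<Rightarrow> int. finite (range \<kappa>) \<and>
    (\<forall>y\<in>L. \<forall>y'\<in>L. \<kappa> y = \<kappa> y' \<longrightarrow> sparse i (y - y'))"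
    unfolding sparse_def E_def
    using pp \<open>\<epsilon> > 0\<close> by (intro allI pure_point_almost_periods[OF point_lattice_axioms]) auto
  from choice[OF this] obtain \<kappa> :: "'m \<Rightarrow> real^'n \<Rightarrow> real^'n \<Rightarrow> int" where
    fin: "\<And>i. finite (range (\<kappa> i))"
    and \<kappa>: "\<And>i y y'. y \<in> L \<Longrightarrow> y' \<in> L \<Longrightarrow> \<kappa> i y = \<kappa> i y' \<Longrightarrow> sparse i (y - y')"
    by blast
  have "(\<lambda>y i. \<kappa> i y) ` L \<subseteq> PiE UNIV (\<lambda>i. range (\<kappa> i))" by auto
  then have "finite ((\<lambda>y i. \<kappa> i y) ` L)"
    by (rule finite_subset) (intro finite_PiE fin finite)
  from sequence_repeats_finite_colouring[OF this, of "\<lambda>n. pow n z"] pow_mem[OF z(1)]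
  obtain M n where Mn: "n \<ge> k" "(\<lambda>i. \<kappa> i (pow (M + n) z)) = (\<lambda>i. \<kappa> i (pow M z))" by blast
  define y where "y = pow (M + n) z - pow M z"
  have y: "y \<in> L" unfolding y_def by (intro diff_mem pow_mem z(1))
  obtain T C where TC: "\<forall>x\<in>L. T x \<in> L \<and> norm (T x - x) \<le> C \<and> c (T x) \<noteq> c (T x + y)"
    "\<forall>X. X \<subseteq> L \<longrightarrow> finite X \<longrightarrow> card X \<le> N * card (T ` X)"
    using dense[OF Mn(1), of M] unfolding y_def[symmetric] by (elim exE conjE) (rule that)
  have T: "T x \<in> L \<and> norm (T x - x) \<le> C \<and> c (T x) \<noteq> c (T x + y)" if "x \<in> L" for x
    using TC(1) that by (rule bspec)
  have card_T: "card X \<le> N * card (T ` X)" if "X \<subseteq> L" "finite X" for X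
    using TC(2) that by simp
  have "sparse i y" for i
    unfolding y_def using fun_cong[OF Mn(2), of i] by (intro \<kappa> pow_mem z(1))
  then have "eventually (\<lambda>r. \<forall>i. real (card (E i y r)) \<le> \<epsilon> * measure lborel (cball (0 :: real^'n) r)) at_top"
    unfolding sparse_def by (rule eventually_all_finite)
  then have "eventually (\<lambda>r :: real. False) at_top"
    using count[of C] eventually_gt_at_top[of 0]
  proof eventually_elim
    case (elim r)
    define v where "v = measure lborel (cball (0 :: real^'n) r)"
    have v: "v > 0" unfolding v_def using elim(3) by (rule content_cball_pos)
    define X where "X = L \<inter> cball 0 (r - C)"
    have finX: "finite X" unfolding X_def by (intro finite_bounded bounded_cball)
    have finE: "finite (E i y r)" for i
      by (rule finite_subset[OF _ finite_bounded[OF bounded_cball, of 0 r]]) (auto simp: E_def)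
    have "T ` X \<subseteq> (\<Union>i. E i y r)"
    proof
      fix w assume "w \<in> T ` X"
      then obtain x where x: "x \<in> L" "norm x \<le> r - C" "w = T x" by (auto simp: X_def)
      have "norm w \<le> r" using T[OF x(1)] x norm_triangle_sub[of w x] by auto
      then have "w \<in> E (c w) y r" using T[OF x(1)] x(3) by (auto simp: E_def)
      then show "w \<in> (\<Union>i. E i y r)" by blast
    qed
    then have "card (T ` X) \<le> card (\<Union>i. E i y r)" using finE by (intro card_mono) auto
    also have "\<dots> \<le> (\<Sum>i\<in>UNIV. card (E i y r))" by (rule card_UN_le) simp
    finally have "real (card (T ` X)) \<le> (\<Sum>i\<in>UNIV. real (card (E i y r)))"
      by (metis of_nat_le_iff of_nat_sum)
    also have "\<dots> \<le> (\<Sum>i\<in>(UNIV :: 'm set). \<epsilon> * v)"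
      using elim(1) unfolding v_def by (intro sum_mono) blast
    also have "\<dots> = CARD('m) * (\<epsilon> * v)" by simp
    finally have TX: "real (card (T ` X)) \<le> CARD('m) * (\<epsilon> * v)" .
    have "\<delta> * v \<le> real (card X)" using elim(2) by (simp add: v_def X_def)
    also have "\<dots> \<le> real N * real (card (T ` X))"
      using card_T[of X] finX by (simp add: X_def flip: of_nat_mult)
    also have "\<dots> \<le> real N * (CARD('m) * (\<epsilon> * v))" using TX by (intro mult_left_mono) auto
    also have "\<dots> = \<delta> * v / 2" using N by (simp add: \<epsilon>_def)
    finally show False using \<delta> v by simp
  qed
  then show False by simp
qed

end

section \<open>The colouring of a lattice substitution system\<close>

lemma substitution_matrix_mult:
  "(substitution_matrix \<Phi> ** P) $ i $ j = (\<Sum>l\<in>UNIV. card (\<Phi> i l) * P $ l $ j)"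
  by (simp add: matrix_matrix_mult_def substitution_matrix_def)

context bijective_substitution
begin

lemma mfs_power_cell:
  fixes \<Phi> :: "('n, 'm) mfs"
  assumes digit: "\<And>i j f. f \<in> \<Phi> i j \<Longrightarrow> \<exists>d\<in>D. f = (\<lambda>x. Q *v x + d)"
    and colour: "\<And>i j f x. f \<in> \<Phi> i j \<Longrightarrow> x \<in> L \<Longrightarrow> c x = j \<Longrightarrow> f x \<in> L \<and> c (f x) = i"
  shows "f \<in> mfs_power \<Phi> k i j \<Longrightarrow>
    (\<exists>a\<in>cell k. f = (\<lambda>x. pow k x + a)) \<and> (\<forall>x\<in>L. c x = j \<longrightarrow> f x \<in> L \<and> c (f x) = i)"
proof (induction k arbitrary: f j)
  case 0
  then show ?case by (auto split: if_splits)
next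
  case (Suc k)
  then obtain l g h where f: "f = g \<circ> h" and g: "g \<in> mfs_power \<Phi> k i l" and h: "h \<in> \<Phi> l j" by auto
  obtain a where a: "a \<in> cell k" "g = (\<lambda>x. pow k x + a)" using Suc.IH[OF g] by blast
  obtain d where d: "d \<in> D" "h = (\<lambda>x. Q *v x + d)" using digit[OF h] by blast
  have "d \<in> cell 1" using d(1) by (auto intro!: exI[of _ 0])
  then have "pow k d + a \<in> cell (Suc k)" using cell_add[OF _ a(1)] by (metis plus_1_eq_Suc)
  moreover have "f = (\<lambda>x. pow (Suc k) x + (pow k d + a))"
    by (simp add: f a(2) d(2) fun_eq_iff pow_add funpow_swap1 add.assoc)
  moreover have "f x \<in> L \<and> c (f x) = i" if "x \<in> L" "c x = j" for x
    using Suc.IH[OF g] colour[OF h that] by (simp add: f)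
  ultimately show ?case by blast
qed

text \<open>
  A positive entry of the matrix power only asserts that a path of maps exists; following it from a
  point of colour \<open>j\<close> leads to a point of colour \<open>i\<close> in its supertile.
\<close>

lemma substitution_matrix_power_cell:
  fixes \<Phi> :: "('n, 'm) mfs"
  assumes digit: "\<And>i j f. f \<in> \<Phi> i j \<Longrightarrow> \<exists>d\<in>D. f = (\<lambda>x. Q *v x + d)"
    and colour: "\<And>i j f x. f \<in> \<Phi> i j \<Longrightarrow> x \<in> L \<Longrightarrow> c x = j \<Longrightarrow> f x \<in> L \<and> c (f x) = i"
  shows "0 < (((**) (substitution_matrix \<Phi>) ^^ k) (mat 1)) $ i $ j \<Longrightarrow> x \<in> L \<Longrightarrow> c x = j \<Longrightarrow>
    \<exists>a\<in>cell k. c (pow k x + a) = i"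
proof (induction k arbitrary: i)
  case 0
  then show ?case by (auto simp: mat_def split: if_splits)
next
  case (Suc k)
  let ?P = "((**) (substitution_matrix \<Phi>) ^^ k) (mat 1)"
  have "0 < (\<Sum>l\<in>UNIV. card (\<Phi> i l) * ?P $ l $ j)"
    using Suc.prems(1) by (simp add: substitution_matrix_mult)
  then obtain l where "0 < card (\<Phi> i l) * ?P $ l $ j"
    by (metis (no_types, lifting) gr0I less_irrefl sum.neutral)
  then have l: "card (\<Phi> i l) > 0" "?P $ l $ j > 0" by auto
  then obtain f where f: "f \<in> \<Phi> i l" by (metis card.empty ex_in_conv less_irrefl)
  obtain d where d: "d \<in> D" "f = (\<lambda>x. Q *v x + d)" using digit[OF f] by blast
  obtain a where a: "a \<in> cell k" "c (pow k x + a) = l" using Suc.IH[OF l(2) Suc.prems(2,3)] by blast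
  have "c (f (pow k x + a)) = i"
    using colour[OF f pow_cell_mem[OF Suc.prems(2) a(1)] a(2)] by blast
  moreover have "f (pow k x + a) = pow (Suc k) x + (Q *v a + d)"
    by (simp add: d(2) matrix_vector_right_distrib add.assoc)
  moreover have "Q *v a + d \<in> cell (Suc k)" using a(1) d(1) by auto
  ultimately show ?case by auto
qed

end

text \<open>
  A real kernel vector would be an eigenvector of the complexified matrix for the eigenvalue 0.
\<close>

lemma expansive_inj:
  fixes Q :: "real^'n^'n"
  assumes "expansive Q"
  shows "inj ((*v) Q)"
proof (rule injI)
  fix x y assume "Q *v x = Q *v y"
  then have v: "Q *v (x - y) = 0" by (simp add: matrix_vector_mult_diff_distrib)
  define u :: "complex^'n" where "u = (\<chi> i. complex_of_real ((x - y) $ i))"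
  have "map_matrix complex_of_real Q *v u = (\<chi> i. complex_of_real ((Q *v (x - y)) $ i))"
    by (simp add: vec_eq_iff u_def map_matrix_def matrix_vector_mult_def)
  also have "\<dots> = 0 *s u" unfolding v by (simp add: vec_eq_iff)
  finally have "u = 0"
    using assms unfolding expansive_def by force
  then show "x = y" by (simp add: u_def vec_eq_iff)
qed

text \<open>
  No map leads from a nonempty component into an empty one, so the corresponding entries vanish in
  every power of the substitution matrix.
\<close>

lemma primitive_lss_components_nonempty:
  assumes prim: "primitive_mfs \<Phi>" and fixed: "mfs_apply \<Phi> V = V"
    and fin: "\<And>i j. finite (\<Phi> i j)" and ne: "V i0 \<noteq> {}"
  shows "V i \<noteq> {}"
proof
  assume i: "V i = {}"
  obtain k where k: "0 < (((**) (substitution_matrix \<Phi>) ^^ k) (mat 1)) $ i $ i0"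
    using prim by (auto simp: primitive_mfs_def)
  have "(((**) (substitution_matrix \<Phi>) ^^ k) (mat 1)) $ i $ i0 = 0"
    using i
  proof (induction k arbitrary: i)
    case 0
    then show ?case using ne by (auto simp: mat_def)
  next
    case (Suc k)
    let ?P = "((**) (substitution_matrix \<Phi>) ^^ k) (mat 1)"
    have "card (\<Phi> i l) * ?P $ l $ i0 = 0" for l
    proof (cases "V l = {}")
      case True
      then show ?thesis using Suc.IH by simp
    next
      case False
      have "f ` V l \<subseteq> V i" if "f \<in> \<Phi> i l" for f
        using that fun_cong[OF fixed, of i] unfolding mfs_apply_def by blast
      then have "\<Phi> i l = {}" using False Suc.prems by auto
      then show ?thesis by simp
    qed
    then show ?case by (simp add: substitution_matrix_mult)
  qed
  with k show False by simp
qed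

definition component_index :: "('m \<Rightarrow> 'a set) \<Rightarrow> 'a \<Rightarrow> 'm" where
  "component_index V x = (THE i. x \<in> V i)"

lemma component_eq:
  assumes "disjoint_family V"
  shows "V i = {x \<in> (\<Union>i. V i). component_index V x = i}"
proof -
  have *: "component_index V x = j" if "x \<in> V j" for x j
    unfolding component_index_def using that disjoint_family_onD[OF assms, of _ j]
    by (intro the_equality) auto
  then show ?thesis by auto
qed

text \<open>
  Every digit \<open>d\<close> occurs in a map, since \<open>d\<close> itself lies in some image \<open>f ` V j\<close> and is congruent to the
  translational part of \<open>f\<close>. That a map occurs once in each row gives a function \<open>\<tau>\<close> from rows to columns. It is
  injective: otherwise the images of a nonempty component would lie in two disjoint ones. The colours
  are thus permuted by the inverse of \<open>\<tau>\<close>.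
\<close>

lemma bijective_lss_is_bijective_substitution:
  fixes Q :: "real^'n^'n" and V :: "'m::finite \<Rightarrow> (real^'n) set" and \<Phi> :: "('n, 'm) mfs"
  assumes lss: "lattice_substitution_system Q V \<Phi>" and prim: "primitive_mfs \<Phi>"
    and adm: "admissible Q V \<Phi>" and bij: "bijective_mfs \<Phi>"
  shows "\<exists>D. bijective_substitution (\<Union>i. V i) Q D (component_index V) \<and>
    (\<forall>i j. \<forall>f\<in>\<Phi> i j. \<exists>d\<in>D. f = (\<lambda>x. Q *v x + d))"
proof -
  define L where "L = (\<Union>i. V i)"
  define c where "c = component_index V"
  have fixed: "mfs_apply \<Phi> V = V" and disj: "disjoint_family V"
    and fin: "\<And>i j. finite (\<Phi> i j)" and "expansive Q" and "euclidean_lattice L"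
    using lss by (auto simp: lattice_substitution_system_def matrix_function_system_def L_def)
  interpret point_lattice L by (rule point_lattice_euclidean) fact
  have V: "V i = {x \<in> L. c x = i}" for i
    unfolding L_def c_def by (rule component_eq[OF disj])
  obtain i0 where "V i0 \<noteq> {}" using zero_mem by (auto simp: L_def)
  then have ne: "V i \<noteq> {}" for i
    by (rule primitive_lss_components_nonempty[OF prim fixed fin])
  obtain D where D: "coset_representatives Q L D" "0 \<in> D"
    and form: "\<And>i j f. f \<in> \<Phi> i j \<Longrightarrow> \<exists>d\<in>D. f = (\<lambda>x. Q *v x + d)"
    using adm by (auto simp: admissible_def L_def)
  have image: "f x \<in> V i" if "f \<in> \<Phi> i j" "x \<in> V j" for f i j x
    using fun_cong[OF fixed, of i] that unfolding mfs_apply_def by blast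
  have DL: "D \<subseteq> L" using D(1) by (simp add: coset_representatives_def)
  have occurs: "(\<lambda>x. Q *v x + d) \<in> (\<Union>i j. \<Phi> i j)" if d: "d \<in> D" for d
  proof -
    obtain i where "d \<in> V i" using d DL by (auto simp: L_def)
    then have "d \<in> mfs_apply \<Phi> V i" using fixed by simp
    then obtain j f x where f: "f \<in> \<Phi> i j" "x \<in> V j" "d = f x" by (auto simp: mfs_apply_def)
    obtain e where e: "e \<in> D" "f = (\<lambda>x. Q *v x + e)" using form[OF f(1)] by blast
    have "\<exists>!d'. d' \<in> D \<and> d - d' \<in> (*v) Q ` L"
      using D(1) d DL by (simp only: coset_representatives_def) blast
    moreover have "d - d \<in> (*v) Q ` L"
      using zero_mem by (intro image_eqI[of _ _ 0]) simp_all
    moreover have "d - e \<in> (*v) Q ` L"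
      using f(2,3) e(2) by (intro image_eqI[of _ _ x]) (auto simp: L_def)
    ultimately have "d = e" using d e(1) by blast
    with f(1) e(2) show ?thesis by blast
  qed
  have law: "\<exists>\<sigma>. bij \<sigma> \<and> (\<forall>x\<in>L. Q *v x + d \<in> L \<and> c (Q *v x + d) = \<sigma> (c x))" if d: "d \<in> D" for d
  proof -
    let ?f = "\<lambda>x. Q *v x + d"
    have "\<forall>i. \<exists>!j. ?f \<in> \<Phi> i j" using bspec[OF bij[unfolded bijective_mfs_def] occurs[OF d]] .
    then obtain \<tau> where \<tau>: "\<And>i. ?f \<in> \<Phi> i (\<tau> i)" by metis
    have "inj \<tau>"
    proof (rule injI)
      fix i i' assume "\<tau> i = \<tau> i'"
      moreover obtain x where "x \<in> V (\<tau> i)" using ne by blast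
      ultimately have "?f x \<in> V i" "?f x \<in> V i'"
        using image[OF \<tau>[of i]] image[OF \<tau>[of i']] by auto
      then show "i = i'" by (simp add: V)
    qed
    then have "bij \<tau>" by (simp add: bij_def finite_UNIV_inj_surj)
    moreover have "?f x \<in> L \<and> c (?f x) = inv_into UNIV \<tau> (c x)" if "x \<in> L" for x
    proof -
      have "x \<in> V (\<tau> (inv_into UNIV \<tau> (c x)))"
        using \<open>bij \<tau>\<close> that by (simp add: V bij_is_surj surj_f_inv_f)
      from image[OF \<tau> this] show ?thesis by (simp add: V)
    qed
    ultimately show ?thesis using bij_imp_bij_inv by blast
  qed
  have "bijective_substitution L Q D c"
  proof
    show "inj ((*v) Q)" by (rule expansive_inj) fact
    show "Q *v x \<in> L" if "x \<in> L" for x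
      using law[OF D(2)] that by auto
    have "D \<subseteq> (\<lambda>f. f 0) ` (\<Union>i j. \<Phi> i j)"
    proof
      fix d assume "d \<in> D"
      from imageI[OF occurs[OF this], of "\<lambda>f. f 0"] show "d \<in> (\<lambda>f. f 0) ` (\<Union>i j. \<Phi> i j)" by simp
    qed
    then show "finite D" by (rule finite_subset) (simp add: fin)
  qed (use D law in blast)+
  with form show ?thesis unfolding L_def c_def by blast
qed

text \<open>
  The translation \<open>t - pow k p\<close> below places the cluster in the cell of the origin instead of the
  inflation of the point \<open>p\<close>.
\<close>

lemma bijective_lss_is_primitive_bijective_substitution:
  fixes Q :: "real^'n^'n" and V :: "'m::finite \<Rightarrow> (real^'n) set" and \<Phi> :: "('n, 'm) mfs"
  assumes lss: "lattice_substitution_system Q V \<Phi>" and prim: "primitive_mfs \<Phi>"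
    and legal: "clusters_legal V \<Phi>" and adm: "admissible Q V \<Phi>" and bij: "bijective_mfs \<Phi>"
    and nonper: "nonperiodic V"
  shows "\<exists>D. primitive_bijective_substitution (\<Union>i. V i) Q D (component_index V)"
proof -
  define L where "L = (\<Union>i. V i)"
  define c where "c = component_index V"
  obtain D where "bijective_substitution L Q D c"
    and form: "\<And>i j f. f \<in> \<Phi> i j \<Longrightarrow> \<exists>d\<in>D. f = (\<lambda>x. Q *v x + d)"
    using bijective_lss_is_bijective_substitution[OF lss prim adm bij] unfolding L_def c_def by blast
  interpret bijective_substitution L Q D c by fact
  have fixed: "mfs_apply \<Phi> V = V" and disj: "disjoint_family V"
    using lss by (auto simp: lattice_substitution_system_def)
  have V: "V i = {x \<in> L. c x = i}" for i
    unfolding L_def c_def by (rule component_eq[OF disj])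
  have colour: "f x \<in> L \<and> c (f x) = i" if "f \<in> \<Phi> i j" "x \<in> L" "c x = j" for i j f x
  proof -
    have "f x \<in> V i" using fun_cong[OF fixed, of i] that V[of j] unfolding mfs_apply_def by blast
    then show ?thesis by (simp add: V)
  qed
  have "primitive_bijective_substitution L Q D c"
  proof
    show "\<exists>k. \<forall>i. \<forall>x\<in>L. \<exists>a\<in>cell k. c (pow k x + a) = i"
    proof -
      obtain k where k: "\<And>i j. 0 < (((**) (substitution_matrix \<Phi>) ^^ k) (mat 1)) $ i $ j"
        using prim by (auto simp: primitive_mfs_def)
      have "\<exists>a\<in>cell k. c (pow k x + a) = i" if "x \<in> L" for i x
        using form colour k that refl by (rule substitution_matrix_power_cell)
      then show ?thesis by blast
    qed
    show "\<exists>k t i. \<forall>u\<in>F. t + u \<in> cell k \<and> (\<forall>x\<in>L. c x = i \<longrightarrow> c (pow k x + (t + u)) = c u)"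
      if F: "F \<subseteq> L" "finite F" for F
    proof -
      obtain r where r: "r > 0" "F \<subseteq> cball 0 r"
        using bounded_subset_ballD[OF finite_imp_bounded[OF F(2)], of 0] ball_subset_cball by blast
      obtain k i p t where cl: "\<And>j. (+) t ` (V j \<inter> cball 0 r) \<subseteq> mfs_apply (mfs_power \<Phi> k) (single_point i p) j"
        using legal r(1) unfolding clusters_legal_def by blast
      have "t - pow k p + u \<in> cell k \<and> (\<forall>x\<in>L. c x = i \<longrightarrow> c (pow k x + (t - pow k p + u)) = c u)"
        if u: "u \<in> F" for u
      proof -
        have "u \<in> V (c u) \<inter> cball 0 r" using u F(1) r(2) V by auto
        then have "t + u \<in> mfs_apply (mfs_power \<Phi> k) (single_point i p) (c u)" using cl by blast
        then obtain f where f: "f \<in> mfs_power \<Phi> k (c u) i" "t + u = f p"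
          by (auto simp: mfs_apply_def single_point_def split: if_splits)
        have *: "(\<exists>a\<in>cell k. f = (\<lambda>x. pow k x + a)) \<and> (\<forall>x\<in>L. c x = i \<longrightarrow> f x \<in> L \<and> c (f x) = c u)"
          using form colour f(1) by (rule mfs_power_cell)
        then obtain a where a: "a \<in> cell k" "f = (\<lambda>x. pow k x + a)" by blast
        have "t - pow k p + u = a" using f(2) a(2) by (simp add: algebra_simps)
        with * a show ?thesis by simp
      qed
      then show ?thesis by blast
    qed
    show "z = 0" if z: "z \<in> L" and per: "\<And>x. x \<in> L \<Longrightarrow> c (x + z) = c x" for z
    proof -
      have "(+) z ` V i = V i" for i
      proof
        show "(+) z ` V i \<subseteq> V i" using per z by (auto simp: V add_mem add.commute[of z])
        show "V i \<subseteq> (+) z ` V i"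
        proof
          fix x assume x: "x \<in> V i"
          then have "x - z \<in> V i" using per[of "x - z"] z by (simp add: V diff_mem)
          then show "x \<in> (+) z ` V i" by (intro image_eqI[of _ _ "x - z"]) auto
        qed
      qed
      then show ?thesis using nonper by (simp add: nonperiodic_def)
    qed
  qed
  then show ?thesis unfolding L_def c_def by blast
qed

theorem corollary4p9:
  fixes Q :: "real^'n^'n"
    and V :: "'m::finite \<Rightarrow> (real^'n) set"
    and \<Phi> :: "('n, 'm) mfs"
  assumes "lattice_substitution_system Q V \<Phi>"
    and "primitive_mfs \<Phi>"
    and "clusters_legal V \<Phi>"
    and "admissible Q V \<Phi>"
    and "bijective_mfs \<Phi>"
    and "nonperiodic V"
  shows "\<not> (\<forall>i. model_set TYPE('h) (V i)) \<and> \<not> pure_point_diffractive V"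
proof -
  obtain D where "primitive_bijective_substitution (\<Union>i. V i) Q D (component_index V)"
    using bijective_lss_is_primitive_bijective_substitution[OF assms] by blast
  then interpret primitive_bijective_substitution "\<Union>i. V i" Q D "component_index V" .
  have V: "V i = {x \<in> (\<Union>i. V i). component_index V x = i}" for i
    using assms(1) by (intro component_eq) (simp add: lattice_substitution_system_def)
  have "\<not> model_set TYPE('h) (V i)" for i
    using not_model_set[where 'h = 'h and i = i] V[of i] by simp
  moreover have "\<exists>i. \<not> pure_point_diffractive_set (V i)"
    using not_pure_point_diffractive V by metis
  ultimately show ?thesis by (auto simp: pure_point_diffractive_def)
qed

end
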